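(* For every boundedly branching computable transition system $T$ there exists a reactive Turing machine $M$ such that $T\leftrightarrow_b^\Delta\mathcal{T}(M)$.
   Context: Fix a finite set $\mathcal{A}$ of action symbols and $\tau\notin\mathcal{A}$; $\mathcal{A}_\tau=\mathcal{A}\cup\{\tau\}$. Fix a finite set $\mathcal{D}$ of data symbols and a blank $\Box\notin\mathcal{D}$; $\mathcal{D}_\Box=\mathcal{D}\cup\{\Box\}$. A transition system is $T=(S,\to,\uparrow,\downarrow)$ with state set $S$, $\to\subseteq S\times\mathcal{A}_\tau\times S$, initial state $\uparrow$, final states $\downarrow\subseteq S$. A reactive Turing machine (RTM) is $M=(S,\to,\uparrow,\downarrow)$ with $S$ finite, $\uparrow\in S$, $\downarrow\subseteq S$, $\to\subseteq S\times\mathcal{D}_\Box\times\mathcal{A}_\tau\times\mathcal{D}_\Box\times\{L,R\}\times S$ (write $s\xrightarrow{d/a/e,X}t$). A tape instance is a finite sequence over $\mathcal{D}_\Box$ and marked symbols $\check d$ ($d\in\mathcal{D}_\Box$) with exactly one marked symbol, identified modulo blanks added/removed at the ends; for $\delta\in\mathcal{D}_\Box^*$, $\overleftarrow{\delta}$ (resp. $\overrightarrow{\delta}$) is $\delta$ with rightmost (resp. leftmost) symbol marked, or $\check\Box$ if $\delta$ is empty. $\mathcal{T}(M)$ is the transition system with states the configurations $(s,\delta)$, transitions $(s,\delta_L\check d\delta_R)\xrightarrow{a}(t,\overleftarrow{\delta_L}e\delta_R)$ iff $s\xrightarrow{d/a/e,L}t$ and $(s,\delta_L\check d\delta_R)\xrightarrow{a}(t,\delta_Le\overrightarrow{\delta_R})$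 iff $s\xrightarrow{d/a/e,R}t$, initial state $(\uparrow,\check\Box)$, final states $\{(s,\delta)\mid s\in\downarrow\}$. $\mathit{out}(s)=\{(a,t)\mid s\xrightarrow{a}t\}$. $T$ is finitely branching if all $\mathit{out}(s)$ are finite; it has branching degree bounded by $B\in\mathbb{N}$ if $|\mathit{out}(s)|\le B$ for all $s$, and is boundedly branching if this holds for some $B$. With fixed injective codings of $\mathcal{A}_\tau$ and of the states into $\mathbb{N}$, a finitely branching $T$ is computable if $\mathit{out}$ and the characteristic function of the final states are recursive. Branching bisimilarity: write $s\xrightarrow{(a)}t$ if $s\xrightarrow{a}t$, or $a=\tau$ and $s=t$; $\twoheadrightarrow$ is the reflexive-transitive and $\twoheadrightarrow^+$ the transitive closure of $\xrightarrow{\tau}$. A branching bisimulation from $T_1$ to $T_2$ is a relation $\mathcal{R}$ between their states such that $s_1\mathcal{R}s_2$ implies: (1) if $s_1\xrightarrow{a}s_1'$ then there are $s_2'',s_2'$ with $s_2\twoheadrightarrow s_2''\xrightarrow{(a)}s_2'$, $s_1\mathcal{R}s_2''$, $s_1'\mathcal{R}s_2'$; (2) symmetrically for transitions of $s_2$; (3) if $s_1$ is final then $s_2\twoheadrightarrow s_2'$ for some final $s_2'$ with $s_1\mathcal{R}s_2'$; (4) symmetrically. It is divergence-preserving if moreover $s_1\mathcal{R}s_2$ implies: (5) if there is an infinite sequence $s_1=s_{1,0}\xrightarrow{\tau}s_{1,1}\xrightarrow{\tau}\cdots$ with $s_{1,i}\mathcal{R}s_2$ for all $i$, then $s_2\twoheadrightarrow^+s_2'$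 with $s_{1,i}\mathcal{R}s_2'$ for some $i$; (6) symmetrically. $T_1\leftrightarrow_b^\Delta T_2$ (divergence-preserving branching bisimilar) if there is a divergence-preserving branching bisimulation relating the initial states.
   Formalization: The set of data symbols is assumed to be nonempty; with no data symbols the tape is always blank, every reactive Turing machine has finitely many configurations, and the claim fails, e.g. for n –a→ n+1 with the perfect squares final. *)

theory Defs
  imports "HOL-Library.Nat_Bijection"
begin

datatype 'a act = Tau | Act 'a

definition act_tau :: "'a set \<Rightarrow> 'a act set" where
  "act_tau A = insert Tau (Act ` A)"

record ('s, 'a) ts =
  states :: "'s set"
  transitions :: "('s \<times> 'a act \<times> 's) set"
  initial :: 's
  finals :: "'s set"

definition transition_system :: "'a set \<Rightarrow> ('s, 'a) ts \<Rightarrow> bool" where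
  "transition_system A T \<longleftrightarrow>
     transitions T \<subseteq> states T \<times> act_tau A \<times> states T \<and>
     initial T \<in> states T \<and> finals T \<subseteq> states T"

definition out :: "('s, 'a) ts \<Rightarrow> 's \<Rightarrow> ('a act \<times> 's) set" where
  "out T s = {(a, t). (s, a, t) \<in> transitions T}"

definition finitely_branching :: "('s, 'a) ts \<Rightarrow> bool" where
  "finitely_branching T \<longleftrightarrow> (\<forall>s\<in>states T. finite (out T s))"

definition branching_degree_le :: "('s, 'a) ts \<Rightarrow> nat \<Rightarrow> bool" where
  "branching_degree_le T B \<longleftrightarrow> (\<forall>s\<in>states T. finite (out T s) \<and> card (out T s) \<le> B)"

definition boundedly_branching :: "('s, 'a) ts \<Rightarrow> bool" where
  "boundedly_branching T \<longleftrightarrow> (\<exists>B. branching_degree_le T B)"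

text \<open>Codes of partial recursive functions. Arities are implicit: a code denotes a partial
  function on argument lists. \<open>PrimRec\<close> and \<open>Mu\<close> recurse on, respectively search for,
  the first argument.\<close>

datatype recf =
    Zero
  | Succ
  | Proj nat
  | Comp recf "recf list"
  | PrimRec recf recf
  | Mu recf

inductive evaluates :: "recf \<Rightarrow> nat list \<Rightarrow> nat \<Rightarrow> bool" where
  zero: "evaluates Zero xs 0"
| succ: "evaluates Succ [x] (Suc x)"
| proj: "i < length xs \<Longrightarrow> evaluates (Proj i) xs (xs ! i)"
| comp: "length ys = length gs \<Longrightarrow> (\<forall>i<length gs. evaluates (gs ! i) xs (ys ! i)) \<Longrightarrow>
    evaluates f ys z \<Longrightarrow> evaluates (Comp f gs) xs z"
| prim_0: "evaluates f xs y \<Longrightarrow> evaluates (PrimRec f g) (0 # xs) y"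
| prim_Suc: "evaluates (PrimRec f g) (n # xs) r \<Longrightarrow> evaluates g (n # r # xs) y \<Longrightarrow>
    evaluates (PrimRec f g) (Suc n # xs) y"
| mu: "evaluates f (n # xs) 0 \<Longrightarrow> (\<forall>k<n. \<exists>y>0. evaluates f (k # xs) y) \<Longrightarrow>
    evaluates (Mu f) xs n"

text \<open>A function \<open>F\<close> on \<open>X\<close> is recursive with respect to a coding \<open>c\<close> of \<open>X\<close> if some recursive
  function yields \<open>F x\<close> on the argument \<open>c x\<close>. Nothing is required, not even definedness,
  on numbers that are not codes of elements of \<open>X\<close>.\<close>

definition recursive_wrt :: "('x \<Rightarrow> nat) \<Rightarrow> 'x set \<Rightarrow> ('x \<Rightarrow> nat) \<Rightarrow> bool" where
  "recursive_wrt c X F \<longleftrightarrow> (\<exists>e. \<forall>x\<in>X. evaluates e [c x] (F x))"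

text \<open>The finite set \<open>out T s\<close> is coded by the canonical index of the set of codes of its
  elements.\<close>

definition out_code :: "('a act \<Rightarrow> nat) \<Rightarrow> ('s \<Rightarrow> nat) \<Rightarrow> ('s, 'a) ts \<Rightarrow> 's \<Rightarrow> nat" where
  "out_code codeA codeS T s =
     set_encode ((\<lambda>(a, t). prod_encode (codeA a, codeS t)) ` out T s)"

definition computable :: "('a act \<Rightarrow> nat) \<Rightarrow> ('s \<Rightarrow> nat) \<Rightarrow> ('s, 'a) ts \<Rightarrow> bool" where
  "computable codeA codeS T \<longleftrightarrow>
     finitely_branching T \<and>
     recursive_wrt codeS (states T) (out_code codeA codeS T) \<and>
     recursive_wrt codeS (states T) (\<lambda>s. if s \<in> finals T then 1 else 0)"

text \<open>The blank is \<open>None\<close>.\<close>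

definition with_blank :: "'d set \<Rightarrow> 'd option set" where
  "with_blank D = insert None (Some ` D)"

datatype dir = MoveL | MoveR

record ('s, 'a, 'd) rtm =
  control :: "'s set"
  rules :: "('s \<times> 'd option \<times> 'a act \<times> 'd option \<times> dir \<times> 's) set"
  start :: 's
  accepting :: "'s set"

definition reactive_turing_machine :: "'a set \<Rightarrow> 'd set \<Rightarrow> ('s, 'a, 'd) rtm \<Rightarrow> bool" where
  "reactive_turing_machine A D M \<longleftrightarrow>
     finite (control M) \<and> start M \<in> control M \<and> accepting M \<subseteq> control M \<and>
     rules M \<subseteq> control M \<times> with_blank D \<times> act_tau A \<times> with_blank D \<times> UNIV \<times> control M"

text \<open>The triple \<open>(l, d, r)\<close> stands for the sequence \<open>l @ d # r\<close> in which the displayed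
  occurrence of \<open>d\<close> is marked. A tape instance is such a sequence up to blanks at either end;
  the marked symbol itself is never removed.\<close>

definition strip_left :: "'d option list \<Rightarrow> 'd option list" where
  "strip_left xs = dropWhile (\<lambda>x. x = None) xs"

definition strip_right :: "'d option list \<Rightarrow> 'd option list" where
  "strip_right xs = rev (strip_left (rev xs))"

fun tape_eq :: "'d option list \<times> 'd option \<times> 'd option list \<Rightarrow>
    'd option list \<times> 'd option \<times> 'd option list \<Rightarrow> bool" where
  "tape_eq (l, d, r) (l', d', r') \<longleftrightarrow>
     strip_left l = strip_left l' \<and> d = d' \<and> strip_right r = strip_right r'"

quotient_type 'd tape = "'d option list \<times> 'd option \<times> 'd option list" / tape_eq
  by (auto intro!: equivpI reflpI sympI transpI)

definition mk_tape :: "'d option list \<Rightarrow> 'd option \<Rightarrow> 'd option list \<Rightarrow> 'd tape" where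
  "mk_tape l d r = abs_tape (l, d, r)"

definition tapes :: "'d set \<Rightarrow> 'd tape set" where
  "tapes D = {mk_tape l d r | l d r. set l \<union> {d} \<union> set r \<subseteq> with_blank D}"

text \<open>\<open>mark_last l w\<close> is \<open>l @ w\<close> with the last symbol of \<open>l\<close> marked, and \<open>mark_first w r\<close>
  is \<open>w @ r\<close> with the first symbol of \<open>r\<close> marked; a marked blank is inserted if \<open>l\<close>,
  respectively \<open>r\<close>, is empty.\<close>

definition mark_last :: "'d option list \<Rightarrow> 'd option list \<Rightarrow> 'd tape" where
  "mark_last l w = (if l = [] then mk_tape [] None w else mk_tape (butlast l) (last l) w)"

definition mark_first :: "'d option list \<Rightarrow> 'd option list \<Rightarrow> 'd tape" where
  "mark_first w r = (if r = [] then mk_tape w None [] else mk_tape w (hd r) (tl r))"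

inductive_set rtm_steps ::
    "'d set \<Rightarrow> ('s, 'a, 'd) rtm \<Rightarrow> (('s \<times> 'd tape) \<times> 'a act \<times> ('s \<times> 'd tape)) set"
  for D :: "'d set" and M :: "('s, 'a, 'd) rtm" where
  left: "(s, d, a, e, MoveL, t) \<in> rules M \<Longrightarrow> set l \<union> set r \<subseteq> with_blank D \<Longrightarrow>
    ((s, mk_tape l d r), a, (t, mark_last l (e # r))) \<in> rtm_steps D M"
| right: "(s, d, a, e, MoveR, t) \<in> rules M \<Longrightarrow> set l \<union> set r \<subseteq> with_blank D \<Longrightarrow>
    ((s, mk_tape l d r), a, (t, mark_first (l @ [e]) r)) \<in> rtm_steps D M"

definition rtm_ts :: "'d set \<Rightarrow> ('s, 'a, 'd) rtm \<Rightarrow> ('s \<times> 'd tape, 'a) ts" where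
  "rtm_ts D M = \<lparr>
     states = control M \<times> tapes D,
     transitions = rtm_steps D M,
     initial = (start M, mk_tape [] None []),
     finals = accepting M \<times> tapes D\<rparr>"

definition tau_rel :: "('s, 'a) ts \<Rightarrow> ('s \<times> 's) set" where
  "tau_rel T = {(s, t). (s, Tau, t) \<in> transitions T}"

definition opt_step :: "('s, 'a) ts \<Rightarrow> 's \<Rightarrow> 'a act \<Rightarrow> 's \<Rightarrow> bool" where
  "opt_step T s a t \<longleftrightarrow> (s, a, t) \<in> transitions T \<or> a = Tau \<and> s = t"

text \<open>The three conditions on the transitions, finality and divergences of the first system;
  the symmetric ones are obtained by passing to the converse relation.\<close>

definition transfer :: "('s, 'a) ts \<Rightarrow> ('t, 'a) ts \<Rightarrow> ('s \<times> 't) set \<Rightarrow> bool" where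
  "transfer T1 T2 R \<longleftrightarrow>
     (\<forall>s1 s2 a s1'. (s1, s2) \<in> R \<longrightarrow> (s1, a, s1') \<in> transitions T1 \<longrightarrow>
        (\<exists>s2'' s2'. (s2, s2'') \<in> (tau_rel T2)\<^sup>* \<and> opt_step T2 s2'' a s2' \<and>
           (s1, s2'') \<in> R \<and> (s1', s2') \<in> R))"

definition transfer_final :: "('s, 'a) ts \<Rightarrow> ('t, 'a) ts \<Rightarrow> ('s \<times> 't) set \<Rightarrow> bool" where
  "transfer_final T1 T2 R \<longleftrightarrow>
     (\<forall>s1 s2. (s1, s2) \<in> R \<longrightarrow> s1 \<in> finals T1 \<longrightarrow>
        (\<exists>s2'\<in>finals T2. (s2, s2') \<in> (tau_rel T2)\<^sup>* \<and> (s1, s2') \<in> R))"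

definition transfer_divergence :: "('s, 'a) ts \<Rightarrow> ('t, 'a) ts \<Rightarrow> ('s \<times> 't) set \<Rightarrow> bool" where
  "transfer_divergence T1 T2 R \<longleftrightarrow>
     (\<forall>s1 s2 \<sigma>. (s1, s2) \<in> R \<longrightarrow>
        \<sigma> 0 = s1 \<longrightarrow> (\<forall>i. (\<sigma> i, \<sigma> (Suc i)) \<in> tau_rel T1) \<longrightarrow> (\<forall>i. (\<sigma> i, s2) \<in> R) \<longrightarrow>
        (\<exists>s2' i. (s2, s2') \<in> (tau_rel T2)\<^sup>+ \<and> (\<sigma> i, s2') \<in> R))"

definition branching_bisimulation ::
    "('s, 'a) ts \<Rightarrow> ('t, 'a) ts \<Rightarrow> ('s \<times> 't) set \<Rightarrow> bool" where
  "branching_bisimulation T1 T2 R \<longleftrightarrow>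
     R \<subseteq> states T1 \<times> states T2 \<and>
     transfer T1 T2 R \<and> transfer T2 T1 (R\<inverse>) \<and>
     transfer_final T1 T2 R \<and> transfer_final T2 T1 (R\<inverse>)"

definition divergence_preserving ::
    "('s, 'a) ts \<Rightarrow> ('t, 'a) ts \<Rightarrow> ('s \<times> 't) set \<Rightarrow> bool" where
  "divergence_preserving T1 T2 R \<longleftrightarrow>
     transfer_divergence T1 T2 R \<and> transfer_divergence T2 T1 (R\<inverse>)"

definition dp_branching_bisimilar :: "('s, 'a) ts \<Rightarrow> ('t, 'a) ts \<Rightarrow> bool" where
  "dp_branching_bisimilar T1 T2 \<longleftrightarrow>
     (\<exists>R. branching_bisimulation T1 T2 R \<and> divergence_preserving T1 T2 R \<and>
        (initial T1, initial T2) \<in> R)"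

end

theory Submission
  imports Defs "HOL-Library.Countable"
begin

text \<open>The machine keeps the code of the current state of \<open>T\<close> on its tape. It deterministically
  computes a number from which the list of actions enabled in that state and its finality can be
  read off; since the branching is bounded and the actions are finitely many, there are finitely
  many such menus, and each can be represented by a control state, which offers exactly these
  actions. Choosing the \<open>i\<close>-th one starts the computation of the code of the \<open>i\<close>-th successor. All
  steps between two menus are silent, forced and finite in number, so they introduce neither
  choices nor divergences. The computations are recursive functions, compiled to counter
  programs, whose registers are interleaved as unary tracks on the tape, so that a single data
  symbol suffices.\<close>

section \<open>Bisimulation by forced silent steps\<close>

text \<open>Branching bisimilarity rules out a machine that searches silently for a successor: a
  silent step that discards an alternative leads in general to a configuration no longer related to
  the same state. So all alternatives must be visible in one control state, yet the codes of the
  successors are unbounded and cannot be stored there. This is why a menu records labels only and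
  lets a position stand in for the successor. Two transitions with the same label become two entries
  with the same action, and nondeterminism is resolved exactly at a step that \<open>T\<close>
  itself makes. The menu number is computed on the tape and has to end up in the finite control. A
  chain of zero tests achieves this; its length is a bound on the menu numbers, and that bound is
  what bounded branching and finiteness of the actions provide. Termination of the silent
  computations comes for free: the recursive functions are run only where they are known to be
  defined, essentially on codes of states.\<close>

text \<open>A machine that announces every choice of \<open>s\<close> in one configuration \<open>rdy s\<close>, and passes to
  \<open>rdy t\<close> after each choice by forced silent steps only, is bisimilar to \<open>T1\<close> via
  \<open>s \<sim> c\<close> iff \<open>c\<close> is forced to reach \<open>rdy s\<close>. Forced runs are finite, so a divergence of the
  machine passes through some \<open>rdy s\<close> and makes a choice there.\<close>

definition det_tau :: "('s, 'a) ts \<Rightarrow> ('s \<times> 's) set" where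
  "det_tau T = {(c, c'). c \<notin> finals T \<and> (\<forall>a c''. (c, a, c'') \<in> transitions T \<longleftrightarrow> a = Tau \<and> c'' = c')}"

lemma det_tau_star_tau: "(c, c') \<in> (det_tau T)\<^sup>* \<Longrightarrow> (c, c') \<in> (tau_rel T)\<^sup>*"
  by (erule rtrancl_mono[THEN subsetD, rotated]) (auto simp: det_tau_def tau_rel_def)

lemma det_tau_step:
  assumes "(c, d) \<in> (det_tau T)\<^sup>*" "(c, a, c') \<in> transitions T"
  shows "c = d \<or> a = Tau \<and> (c', d) \<in> (det_tau T)\<^sup>*"
  using assms(1)
proof (cases rule: converse_rtranclE)
  case (step y)
  with assms(2) have "a = Tau \<and> c' = y" by (auto simp: det_tau_def)
  with step show ?thesis by simp
qed simp

text \<open>A forced configuration has exactly one transition, so an arbitrary infinite silent path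
  cannot leave the forced run before \<open>d\<close>.\<close>

lemma det_tau_path_hits:
  assumes "(c, d) \<in> (det_tau T)\<^sup>*" "\<sigma> 0 = c" "\<forall>i. (\<sigma> i, \<sigma> (Suc i)) \<in> tau_rel T"
  shows "\<exists>n. \<sigma> n = d"
  using assms
proof (induction arbitrary: \<sigma> rule: converse_rtrancl_induct)
  case base
  then show ?case by blast
next
  case (step c c')
  have "(c, Tau, \<sigma> 1) \<in> transitions T"
    using step.prems by (metis One_nat_def case_prodD mem_Collect_eq tau_rel_def)
  with step.hyps have "\<sigma> 1 = c'" by (auto simp: det_tau_def)
  with step.IH[of "\<lambda>i. \<sigma> (Suc i)"] step.prems show ?case by auto
qed

lemma dp_bisimilar_by_det_tau:
  fixes T1 :: "('s, 'a) ts" and T2 :: "('t, 'a) ts"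
  assumes T1: "transition_system A T1"
    and T2: "transitions T2 \<subseteq> states T2 \<times> UNIV \<times> states T2"
    and rdy: "\<And>s. s \<in> states T1 \<Longrightarrow> rdy s \<in> states T2"
    and fin: "\<And>s. s \<in> states T1 \<Longrightarrow> rdy s \<in> finals T2 \<longleftrightarrow> s \<in> finals T1"
    and fwd: "\<And>s a t. (s, a, t) \<in> transitions T1 \<Longrightarrow>
      \<exists>c. (rdy s, a, c) \<in> transitions T2 \<and> (c, rdy t) \<in> (det_tau T2)\<^sup>*"
    and bwd: "\<And>s a c. s \<in> states T1 \<Longrightarrow> (rdy s, a, c) \<in> transitions T2 \<Longrightarrow>
      \<exists>t. (s, a, t) \<in> transitions T1 \<and> (c, rdy t) \<in> (det_tau T2)\<^sup>*"
    and init: "(initial T2, rdy (initial T1)) \<in> (det_tau T2)\<^sup>*"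
  shows "dp_branching_bisimilar T1 T2"
proof -
  define R where "R = {(s, c). s \<in> states T1 \<and> (c, rdy s) \<in> (det_tau T2)\<^sup>*}"
  have tr1: "(s, a, t) \<in> transitions T1 \<Longrightarrow> s \<in> states T1 \<and> t \<in> states T1" for s a t
    using T1 by (auto simp: transition_system_def)
  have "c \<in> states T2" if "(s, c) \<in> R" for s c
  proof -
    from that have "(c, rdy s) \<in> (tau_rel T2)\<^sup>*" "s \<in> states T1"
      by (auto simp: R_def dest: det_tau_star_tau)
    then show ?thesis
      by (cases rule: converse_rtranclE) (use rdy T2 in \<open>auto simp: tau_rel_def\<close>)
  qed
  then have sub: "R \<subseteq> states T1 \<times> states T2"
    by (auto simp: R_def)
  have rdyR: "s \<in> states T1 \<Longrightarrow> (s, rdy s) \<in> R" for s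
    by (auto simp: R_def)
  \<comment> \<open>The step out of \<open>rdy s\<close> is genuine even when \<open>a\<close> is
    \<open>Tau\<close>, so this fact also yields the nonempty silent run that the divergence
    condition demands.\<close>
  have t1: "\<exists>c'. (c, rdy s) \<in> (tau_rel T2)\<^sup>* \<and> (rdy s, a, c') \<in> transitions T2 \<and> (s, rdy s) \<in> R \<and> (t, c') \<in> R"
    if "(s, c) \<in> R" "(s, a, t) \<in> transitions T1" for s c a t
    using fwd[OF that(2)] that tr1[OF that(2)] by (auto simp: R_def dest: det_tau_star_tau)
  \<comment> \<open>A forced step is answered by \<open>T1\<close> standing still; only a step out
    of \<open>rdy s\<close> moves it.\<close>
  have t2: "\<exists>t. opt_step T1 s a t \<and> (t, c') \<in> R" if "(s, c) \<in> R" "(c, a, c') \<in> transitions T2" for s c a c'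
    using det_tau_step[of c "rdy s" T2 a c'] bwd[of s a c'] that tr1
    by (auto simp: R_def opt_step_def)
  have "transfer T1 T2 R"
    unfolding transfer_def opt_step_def using t1 by blast
  moreover have "transfer T2 T1 (R\<inverse>)"
    unfolding transfer_def using t2 by (meson converse_iff rtrancl.rtrancl_refl)
  moreover have "transfer_final T1 T2 R"
    unfolding transfer_final_def using fin rdyR by (auto simp: R_def dest: det_tau_star_tau)
  moreover have "transfer_final T2 T1 (R\<inverse>)"
    unfolding transfer_final_def
  proof (intro allI impI)
    fix c s assume *: "(c, s) \<in> R\<inverse>" "c \<in> finals T2"
    then have "(c, rdy s) \<in> (det_tau T2)\<^sup>*" by (simp add: R_def)
    \<comment> \<open>\<open>det_tau\<close> demands a non-final source, so a forced run that starts
      in a final configuration is empty.\<close>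
    then have "c = rdy s"
      by (cases rule: converse_rtranclE) (use *(2) in \<open>auto simp: det_tau_def\<close>)
    with * fin show "\<exists>s2'\<in>finals T1. (s, s2') \<in> (tau_rel T1)\<^sup>* \<and> (c, s2') \<in> R\<inverse>"
      by (auto simp: R_def)
  qed
  moreover have "transfer_divergence T1 T2 R"
    unfolding transfer_divergence_def
  proof (intro allI impI)
    fix s c \<sigma> assume *: "(s, c) \<in> R" "\<sigma> 0 = s" "\<forall>i. (\<sigma> i, \<sigma> (Suc i)) \<in> tau_rel T1"
    then have "(s, Tau, \<sigma> (Suc 0)) \<in> transitions T1"
      by (metis case_prodD mem_Collect_eq tau_rel_def)
    from t1[OF *(1) this] obtain c' where "(c, rdy s) \<in> (tau_rel T2)\<^sup>*"
      "(rdy s, c') \<in> tau_rel T2" "(\<sigma> (Suc 0), c') \<in> R" by (auto simp: tau_rel_def)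
    then show "\<exists>c' i. (c, c') \<in> (tau_rel T2)\<^sup>+ \<and> (\<sigma> i, c') \<in> R"
      by (meson rtrancl_into_trancl1)
  qed
  moreover have "transfer_divergence T2 T1 (R\<inverse>)"
    unfolding transfer_divergence_def
  proof (intro allI impI)
    fix c s \<sigma> assume *: "(c, s) \<in> R\<inverse>" "\<sigma> 0 = c" "\<forall>i. (\<sigma> i, \<sigma> (Suc i)) \<in> tau_rel T2"
    then have s: "s \<in> states T1" "(c, rdy s) \<in> (det_tau T2)\<^sup>*" by (auto simp: R_def)
    from det_tau_path_hits[OF s(2) *(2,3)] obtain n where n: "\<sigma> n = rdy s" ..
    with *(3) have "(rdy s, Tau, \<sigma> (Suc n)) \<in> transitions T2"
      by (metis case_prodD mem_Collect_eq tau_rel_def)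
    from bwd[OF s(1) this] obtain t where "(s, Tau, t) \<in> transitions T1"
      "(\<sigma> (Suc n), rdy t) \<in> (det_tau T2)\<^sup>*" by blast
    then show "\<exists>s' i. (s, s') \<in> (tau_rel T1)\<^sup>+ \<and> (\<sigma> i, s') \<in> R\<inverse>"
      using tr1 by (auto simp: R_def tau_rel_def)
  qed
  ultimately show ?thesis
    unfolding dp_branching_bisimilar_def branching_bisimulation_def divergence_preserving_def
    using sub init T1 by (intro exI[of _ R]) (auto simp: R_def transition_system_def)
qed

section \<open>Tapes as functions on the integers\<close>

definition nth_blank :: "'d option list \<Rightarrow> nat \<Rightarrow> 'd option" where
  "nth_blank xs i = (if i < length xs then xs ! i else None)"

lemma nth_blank_Nil [simp]: "nth_blank [] i = None"
  by (simp add: nth_blank_def)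

lemma nth_blank_Cons: "nth_blank (x # xs) i = (case i of 0 \<Rightarrow> x | Suc j \<Rightarrow> nth_blank xs j)"
  by (simp add: nth_blank_def split: nat.split)

lemma strip_right_snoc: "strip_right (xs @ [x]) = (if x = None then strip_right xs else xs @ [x])"
  by (simp add: strip_right_def strip_left_def)

lemma nth_blank_strip_right: "nth_blank (strip_right xs) = nth_blank xs"
proof (induction xs rule: rev_induct)
  case Nil
  then show ?case by (simp add: strip_right_def strip_left_def)
next
  case (snoc x xs)
  then show ?case
    by (cases "x = None") (auto simp: strip_right_snoc nth_blank_def nth_append fun_eq_iff)
qed

lemma last_strip_right: "strip_right xs \<noteq> [] \<Longrightarrow> last (strip_right xs) \<noteq> None"
  by (induction xs rule: rev_induct) (auto simp: strip_right_snoc, simp add: strip_right_def strip_left_def)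

lemma nth_blank_length_le:
  assumes "nth_blank xs = nth_blank ys" "ys = [] \<or> last ys \<noteq> None"
  shows "length ys \<le> length xs"
proof (rule ccontr)
  assume "\<not> ?thesis"
  then have l: "length xs < length ys" by simp
  then have "nth_blank xs (length ys - 1) = None" "ys \<noteq> []"
    by (auto simp: nth_blank_def)
  with assms l show False by (auto simp: nth_blank_def last_conv_nth)
qed

text \<open>Stripping keeps the cells and leaves a nonblank last symbol, so equal cells force equal
  lengths in both directions, and then equal entries.\<close>

lemma strip_right_eq_iff: "strip_right xs = strip_right ys \<longleftrightarrow> nth_blank xs = nth_blank ys"
proof
  assume "nth_blank xs = nth_blank ys"
  then have eq: "nth_blank (strip_right xs) = nth_blank (strip_right ys)"
    by (simp add: nth_blank_strip_right)
  then have "length (strip_right xs) = length (strip_right ys)"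
    by (intro antisym nth_blank_length_le) (use last_strip_right in auto)
  with eq show "strip_right xs = strip_right ys"
    by (intro nth_equalityI) (auto simp: nth_blank_def fun_eq_iff split: if_splits)
qed (metis nth_blank_strip_right)

lemma strip_left_eq_iff: "strip_left xs = strip_left ys \<longleftrightarrow> nth_blank (rev xs) = nth_blank (rev ys)"
  unfolding strip_right_eq_iff[symmetric] by (simp add: strip_right_def)

text \<open>Cells are numbered relative to the head, which always sits at 0. A move then becomes a
  translation of the whole tape.\<close>

fun triple_cell :: "'d option list \<times> 'd option \<times> 'd option list \<Rightarrow> int \<Rightarrow> 'd option" where
  "triple_cell (l, d, r) i = (if i = 0 then d else if i > 0 then nth_blank r (nat (i - 1))
     else nth_blank (rev l) (nat (- i - 1)))"

lemma tape_eq_iff: "tape_eq x y \<longleftrightarrow> triple_cell x = triple_cell y"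
proof -
  obtain l d r where x: "x = (l, d, r)" by (cases x)
  obtain l' d' r' where y: "y = (l', d', r')" by (cases y)
  have "nth_blank r = nth_blank r' \<and> d = d' \<and> nth_blank (rev l) = nth_blank (rev l')"
    if "triple_cell x = triple_cell y"
  proof (intro conjI ext)
    show "d = d'" using fun_cong[OF that, of 0] by (simp add: x y)
    fix i
    show "nth_blank r i = nth_blank r' i" using fun_cong[OF that, of "int i + 1"] by (simp add: x y)
    show "nth_blank (rev l) i = nth_blank (rev l') i"
      using fun_cong[OF that, of "- int i - 1"] by (simp add: x y)
  qed
  then show ?thesis
    by (auto simp: x y strip_left_eq_iff strip_right_eq_iff)
qed

lift_definition cell :: "'d tape \<Rightarrow> int \<Rightarrow> 'd option" is triple_cell
  by (simp add: tape_eq_iff)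

lemma cell_inject: "cell x = cell y \<longleftrightarrow> x = y"
  by transfer (simp add: tape_eq_iff)

lemma cell_mk_tape: "cell (mk_tape l d r) = triple_cell (l, d, r)"
  unfolding mk_tape_def by (simp add: cell.abs_eq)

definition shift :: "dir \<Rightarrow> int" where
  "shift X = (case X of MoveL \<Rightarrow> - 1 | MoveR \<Rightarrow> 1)"

lemma cell_mark_last:
  "cell (mark_last l (e # r)) = (\<lambda>i. ((cell (mk_tape l d r))(0 := e)) (i + shift MoveL))"
proof (cases l rule: rev_cases)
  case Nil
  then show ?thesis
    by (auto simp: mark_last_def cell_mk_tape shift_def fun_eq_iff nth_blank_Cons split: nat.split
        intro!: arg_cong[where f = "nth_blank r"])
next
  case (snoc l' x)
  then show ?thesis
    by (auto simp: mark_last_def cell_mk_tape shift_def fun_eq_iff nth_blank_Cons split: nat.split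
        intro!: arg_cong[where f = "nth_blank _"])
qed

lemma cell_mark_first:
  "cell (mark_first (l @ [e]) r) = (\<lambda>i. ((cell (mk_tape l d r))(0 := e)) (i + shift MoveR))"
  by (cases r) (auto simp: mark_first_def cell_mk_tape shift_def fun_eq_iff nth_blank_Cons
      split: nat.split intro!: arg_cong[where f = "nth_blank _"])

section \<open>Recursive functions for decoding finite sets\<close>

text \<open>Totality on all lists of length \<open>n\<close> keeps the closure rules free of
  definedness conditions. Partial functions enter only with the codes given for
  \<open>T\<close>.\<close>

definition rec_fun :: "nat \<Rightarrow> (nat list \<Rightarrow> nat) \<Rightarrow> bool" where
  "rec_fun n F \<longleftrightarrow> (\<exists>e. \<forall>xs. length xs = n \<longrightarrow> evaluates e xs (F xs))"

lemma rec_fun_nth: "i < n \<Longrightarrow> rec_fun n (\<lambda>xs. xs ! i)"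
  unfolding rec_fun_def by (metis evaluates.proj)

lemma rec_fun_zero: "rec_fun n (\<lambda>xs. 0)"
  unfolding rec_fun_def by (meson evaluates.zero)

lemma rec_fun_comp:
  assumes "rec_fun m F" "length Gs = m" "\<And>G. G \<in> set Gs \<Longrightarrow> rec_fun n G"
  shows "rec_fun n (\<lambda>xs. F (map (\<lambda>G. G xs) Gs))"
proof -
  obtain f where f: "\<And>xs. length xs = m \<Longrightarrow> evaluates f xs (F xs)"
    using assms(1) by (auto simp: rec_fun_def)
  obtain g where g: "\<And>G xs. G \<in> set Gs \<Longrightarrow> length xs = n \<Longrightarrow> evaluates (g G) xs (G xs)"
    using assms(3) unfolding rec_fun_def by metis
  show ?thesis
    unfolding rec_fun_def
  proof (intro exI allI impI)
    fix xs :: "nat list" assume "length xs = n"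
    then show "evaluates (Comp f (map g Gs)) xs (F (map (\<lambda>G. G xs) Gs))"
      using f g assms(2) by (intro evaluates.comp[where ys = "map (\<lambda>G. G xs) Gs"]) auto
  qed
qed

lemma rec_fun_comp1: "rec_fun (Suc 0) (\<lambda>xs. f (xs ! 0)) \<Longrightarrow> rec_fun n G \<Longrightarrow> rec_fun n (\<lambda>xs. f (G xs))"
  using rec_fun_comp[of "Suc 0" "\<lambda>xs. f (xs ! 0)" "[G]" n] by simp

lemma rec_fun_comp2:
  "rec_fun 2 (\<lambda>xs. f (xs ! 0) (xs ! 1)) \<Longrightarrow> rec_fun n G \<Longrightarrow> rec_fun n H \<Longrightarrow>
    rec_fun n (\<lambda>xs. f (G xs) (H xs))"
  using rec_fun_comp[of 2 "\<lambda>xs. f (xs ! 0) (xs ! 1)" "[G, H]" n] by auto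

lemma rec_fun_Suc: "rec_fun n G \<Longrightarrow> rec_fun n (\<lambda>xs. Suc (G xs))"
proof (erule rec_fun_comp1[rotated])
  show "rec_fun (Suc 0) (\<lambda>xs. Suc (xs ! 0))"
    unfolding rec_fun_def
    by (rule exI[of _ Succ]) (auto simp: length_Suc_conv intro: evaluates.succ)
qed

lemma rec_fun_const: "rec_fun n (\<lambda>xs. c)"
  by (induction c) (auto intro: rec_fun_zero rec_fun_Suc)

lemma rec_fun_prim:
  assumes "rec_fun n F" "rec_fun (Suc (Suc n)) G"
  shows "rec_fun (Suc n) (\<lambda>xs. rec_nat (F (tl xs)) (\<lambda>i r. G (i # r # tl xs)) (hd xs))"
proof -
  obtain f where f: "\<And>xs. length xs = n \<Longrightarrow> evaluates f xs (F xs)"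
    using assms(1) by (auto simp: rec_fun_def)
  obtain g where g: "\<And>xs. length xs = Suc (Suc n) \<Longrightarrow> evaluates g xs (G xs)"
    using assms(2) by (auto simp: rec_fun_def)
  have "evaluates (PrimRec f g) (k # xs) (rec_nat (F xs) (\<lambda>i r. G (i # r # xs)) k)"
    if "length xs = n" for k xs
  proof (induction k)
    case 0
    show ?case using f[OF that] by (auto intro: evaluates.prim_0)
  next
    case (Suc k)
    then show ?case using g that by (auto intro: evaluates.prim_Suc)
  qed
  then show ?thesis
    unfolding rec_fun_def by (intro exI[of _ "PrimRec f g"]) (auto simp: length_Suc_conv)
qed

lemma rec_fun_mu:
  assumes "rec_fun (Suc n) F" "\<And>xs. length xs = n \<Longrightarrow> \<exists>k. F (k # xs) = 0"
  shows "rec_fun n (\<lambda>xs. LEAST k. F (k # xs) = 0)"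
proof -
  obtain f where f: "\<And>xs. length xs = Suc n \<Longrightarrow> evaluates f xs (F xs)"
    using assms(1) by (auto simp: rec_fun_def)
  have "evaluates (Mu f) xs (LEAST k. F (k # xs) = 0)" if l: "length xs = n" for xs
  proof (rule evaluates.mu)
    show "evaluates f ((LEAST k. F (k # xs) = 0) # xs) 0"
      using LeastI_ex[OF assms(2)[OF l]] f[of "_ # xs"] l by (metis length_Cons)
    show "\<forall>k<LEAST k. F (k # xs) = 0. \<exists>y>0. evaluates f (k # xs) y"
    proof (intro allI impI)
      fix k assume "k < (LEAST k. F (k # xs) = 0)"
      then have "F (k # xs) > 0" by (auto dest: not_less_Least)
      then show "\<exists>y>0. evaluates f (k # xs) y" using f[of "k # xs"] l by auto
    qed
  qed
  then show ?thesis unfolding rec_fun_def by blast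
qed

lemma rec_fun_prim1:
  assumes "rec_fun 2 (\<lambda>xs. g (xs ! 0) (xs ! 1))" "rec_fun n G"
    "f 0 = c" "\<And>k. f (Suc k) = g k (f k)"
  shows "rec_fun n (\<lambda>xs. f (G xs))"
proof (rule rec_fun_comp1[OF _ assms(2)])
  have "f k = rec_nat c g k" for k by (induction k) (auto simp: assms)
  moreover have "rec_fun (Suc 0) (\<lambda>xs. rec_nat c (\<lambda>i r. g i r) (hd xs))"
    using rec_fun_prim[of 0 "\<lambda>_. c" "\<lambda>xs. g (xs ! 0) (xs ! 1)"] assms(1)
    by (simp add: rec_fun_const numeral_2_eq_2)
  ultimately show "rec_fun (Suc 0) (\<lambda>xs. f (xs ! 0))"
    unfolding rec_fun_def by (elim ex_forward) (auto simp: length_Suc_conv)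
qed

lemma rec_fun_prim2:
  assumes "rec_fun (Suc 0) (\<lambda>xs. h (xs ! 0))" "rec_fun 3 (\<lambda>xs. g (xs ! 0) (xs ! 1) (xs ! 2))"
    "rec_fun n G" "rec_fun n H"
    "\<And>y. f 0 y = h y" "\<And>k y. f (Suc k) y = g k (f k y) y"
  shows "rec_fun n (\<lambda>xs. f (G xs) (H xs))"
proof (rule rec_fun_comp2[OF _ assms(3,4)])
  have f: "f k y = rec_nat (h y) (\<lambda>i r. g i r y) k" for k y by (induction k) (auto simp: assms)
  have "rec_fun (Suc (Suc 0)) (\<lambda>xs. rec_nat (h (tl xs ! 0)) (\<lambda>i r. g i r (tl xs ! 0)) (hd xs))"
    using rec_fun_prim[OF assms(1), of "\<lambda>xs. g (xs ! 0) (xs ! 1) (xs ! 2)"] assms(2)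
    by (simp add: numeral_2_eq_2 numeral_3_eq_3)
  then show "rec_fun 2 (\<lambda>xs. f (xs ! 0) (xs ! 1))"
    unfolding rec_fun_def numeral_2_eq_2
  proof (elim ex_forward, intro allI)
    fix e :: recf and xs :: "nat list"
    assume *: "\<forall>xs. length xs = Suc (Suc 0) \<longrightarrow> evaluates e xs (rec_nat (h (tl xs ! 0)) (\<lambda>i r. g i r (tl xs ! 0)) (hd xs))"
    show "length xs = Suc (Suc 0) \<longrightarrow> evaluates e xs (f (xs ! 0) (xs ! 1))" using *[rule_format, of xs]
      by (auto simp: length_Suc_conv f)
  qed
qed

section \<open>Arithmetic and the inverse of the Cantor pairing\<close>

lemma rec_fun_add: "rec_fun n G \<Longrightarrow> rec_fun n H \<Longrightarrow> rec_fun n (\<lambda>xs. G xs + H xs)"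
  by (rule rec_fun_prim2[where f = "(+)" and h = "\<lambda>y. y" and g = "\<lambda>k r y. Suc r"])
     (auto simp del: One_nat_def intro!: rec_fun_nth rec_fun_Suc)

lemma rec_fun_diff: 
  assumes "rec_fun n G" "rec_fun n H" shows "rec_fun n (\<lambda>xs. G xs - H xs)"
proof -
  have pred: "rec_fun m G \<Longrightarrow> rec_fun m (\<lambda>xs. G xs - 1)" for m G
    by (rule rec_fun_prim1[where f = "\<lambda>x. x - 1" and g = "\<lambda>k r. k"]) (auto simp del: One_nat_def intro!: rec_fun_nth)
  show ?thesis
    by (rule rec_fun_prim2[where f = "\<lambda>y x. x - y" and h = "\<lambda>y. y" and g = "\<lambda>k r y. r - 1"])
       (auto simp del: One_nat_def intro!: rec_fun_nth pred assms)
qed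

lemma rec_fun_parity: "rec_fun n G \<Longrightarrow> rec_fun n (\<lambda>xs. G xs mod 2)"
  by (rule rec_fun_prim1[where f = "\<lambda>x. x mod 2" and g = "\<lambda>k r. 1 - r"])
     (auto simp del: One_nat_def intro!: rec_fun_nth rec_fun_diff rec_fun_const simp: mod_Suc)

lemma Suc_div_two_eq: "Suc k div 2 = k div 2 + k mod 2"
  by presburger

lemma rec_fun_half: "rec_fun n G \<Longrightarrow> rec_fun n (\<lambda>xs. G xs div 2)"
  by (rule rec_fun_prim1[where f = "\<lambda>x. x div 2" and g = "\<lambda>k r. r + k mod 2"])
     (auto simp del: One_nat_def intro!: rec_fun_nth rec_fun_add rec_fun_parity simp: Suc_div_two_eq)

lemma rec_fun_div_power2: "rec_fun n G \<Longrightarrow> rec_fun n H \<Longrightarrow> rec_fun n (\<lambda>xs. G xs div 2 ^ H xs)"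
  by (rule rec_fun_prim2[where f = "\<lambda>k y. y div 2 ^ k" and h = "\<lambda>y. y" and g = "\<lambda>k r y. r div 2"])
     (auto simp del: One_nat_def intro!: rec_fun_nth rec_fun_half simp: div_mult2_eq mult.commute[of 2])

lemma rec_fun_power2: "rec_fun n G \<Longrightarrow> rec_fun n (\<lambda>xs. 2 ^ G xs)"
  by (rule rec_fun_prim1[where f = "\<lambda>x. 2 ^ x" and g = "\<lambda>k r. r + r"])
     (auto simp del: One_nat_def intro!: rec_fun_nth rec_fun_add)

lemma rec_fun_triangle: "rec_fun n G \<Longrightarrow> rec_fun n (\<lambda>xs. triangle (G xs))"
  by (rule rec_fun_prim1[where f = triangle and g = "\<lambda>k r. r + Suc k"])
     (auto simp del: One_nat_def intro!: rec_fun_nth rec_fun_add rec_fun_Suc)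

lemma rec_fun_prod_encode:
  "rec_fun n G \<Longrightarrow> rec_fun n H \<Longrightarrow> rec_fun n (\<lambda>xs. prod_encode (G xs, H xs))"
  by (simp add: prod_encode_def rec_fun_add rec_fun_triangle)

lemma rec_fun_if0:
  assumes "rec_fun n G" "rec_fun n H"
  shows "rec_fun n (\<lambda>xs. if G xs = 0 then 0 else H xs)"
  by (rule rec_fun_prim2[where f = "\<lambda>x y. if x = 0 then 0 else y" and h = "\<lambda>y. 0" and g = "\<lambda>k r y. y"])
     (auto simp del: One_nat_def intro!: rec_fun_nth rec_fun_const assms)

text \<open>The codes of the pairs with sum \<open>k\<close> fill the interval from
  \<open>triangle k\<close> up to, but excluding, \<open>triangle (Suc k)\<close>. So the sum is the
  first \<open>k\<close> whose next triangle number exceeds the code, and truncated subtraction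
  turns this comparison into a zero test.\<close>

lemma prod_encode_sum_least: "(LEAST k. Suc (prod_encode (a, b)) - triangle (Suc k) = 0) = a + b"
proof (rule Least_equality)
  fix k assume "Suc (prod_encode (a, b)) - triangle (Suc k) = 0"
  then have *: "triangle (a + b) + a < triangle (Suc k)" by (simp add: prod_encode_def)
  show "a + b \<le> k"
  proof (rule ccontr)
    assume "\<not> a + b \<le> k"
    then have "Suc k \<le> a + b" by simp
    then have "triangle (Suc k) \<le> triangle (a + b)"
      by (induction rule: dec_induct) auto
    with * show False by simp
  qed
qed (simp add: prod_encode_def)

lemma rec_fun_decode_sum:
  assumes "rec_fun n G"
  shows "rec_fun n (\<lambda>xs. fst (prod_decode (G xs)) + snd (prod_decode (G xs)))"
proof (rule rec_fun_comp1[OF _ assms])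
  have eq: "fst (prod_decode m) + snd (prod_decode m) = (LEAST k. Suc m - triangle (Suc k) = 0)" for m
    using prod_encode_sum_least[of "fst (prod_decode m)" "snd (prod_decode m)"] by simp
  \<comment> \<open>The search must always succeed: \<open>k = m\<close> is a zero, because
    \<open>Suc m \<le> triangle (Suc m)\<close>.\<close>
  have le: "m \<le> triangle m" for m by (induction m) auto
  have "rec_fun (Suc 0) (\<lambda>xs. LEAST k. Suc ((k # xs) ! 1) - triangle (Suc ((k # xs) ! 0)) = 0)"
    by (rule rec_fun_mu[where F = "\<lambda>xs. Suc (xs ! 1) - triangle (Suc (xs ! 0))"])
       (auto intro!: rec_fun_diff rec_fun_Suc rec_fun_triangle rec_fun_nth intro: trans_le_add1 le simp del: triangle_Suc)
  then show "rec_fun (Suc 0) (\<lambda>xs. fst (prod_decode (xs ! 0)) + snd (prod_decode (xs ! 0)))"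
    by (simp add: eq del: triangle_Suc)
qed

lemma rec_fun_fst_decode:
  assumes "rec_fun n G" shows "rec_fun n (\<lambda>xs. fst (prod_decode (G xs)))"
proof -
  have "fst (prod_decode m) = m - triangle (fst (prod_decode m) + snd (prod_decode m))" for m
  proof -
    have "triangle (fst (prod_decode m) + snd (prod_decode m)) + fst (prod_decode m) = m"
      using prod_decode_inverse[of m] by (simp add: prod_encode_def split_beta)
    then show ?thesis by linarith
  qed
  then have "(\<lambda>xs. fst (prod_decode (G xs))) =
      (\<lambda>xs. G xs - triangle (fst (prod_decode (G xs)) + snd (prod_decode (G xs))))"
    by blast
  moreover have "rec_fun n \<dots>"
    by (intro rec_fun_diff assms rec_fun_triangle rec_fun_decode_sum)
  ultimately show ?thesis by (simp only:)
qed

lemma rec_fun_snd_decode: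
  assumes "rec_fun n G" shows "rec_fun n (\<lambda>xs. snd (prod_decode (G xs)))"
  using rec_fun_diff[OF rec_fun_decode_sum[OF assms] rec_fun_fst_decode[OF assms]] by simp

text \<open>\<open>1 - (1 - n)\<close> is the sign of \<open>n\<close>, which makes the search succeed (with junk value \<open>0\<close>) for
  \<open>n = 0\<close> as well.\<close>

definition min_elem :: "nat \<Rightarrow> nat" where
  "min_elem n = (LEAST x. (1 - (1 - n)) - (n div 2 ^ x) mod 2 = 0)"

definition del_min :: "nat \<Rightarrow> nat" where
  "del_min n = n - 2 ^ min_elem n"

lemma min_elem_ex: "\<exists>x. (1 - (1 - n)) - (n div 2 ^ x) mod 2 = (0 :: nat)"
proof (cases "n = 0")
  case False
  then have "set_decode n \<noteq> {}" by (metis set_decode_inverse set_encode_empty)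
  then obtain x where "n div 2 ^ x mod 2 = 1"
    by (auto simp: set_decode_def odd_iff_mod_2_eq_one)
  with False show ?thesis by (intro exI[of _ x]) simp
qed simp

lemma rec_fun_min_elem: "rec_fun n G \<Longrightarrow> rec_fun n (\<lambda>xs. min_elem (G xs))"
proof (erule rec_fun_comp1[rotated])
  have "rec_fun (Suc 0) (\<lambda>xs. LEAST k. (1 - (1 - (k # xs) ! 1)) - ((k # xs) ! 1 div 2 ^ ((k # xs) ! 0)) mod 2 = 0)"
    by (rule rec_fun_mu[where F = "\<lambda>xs. (1 - (1 - xs ! 1)) - (xs ! 1 div 2 ^ (xs ! 0)) mod 2"])
       (use min_elem_ex in \<open>auto intro!: rec_fun_diff rec_fun_const rec_fun_parity
          rec_fun_div_power2 rec_fun_nth simp del: One_nat_def diff_diff_left\<close>)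
  then show "rec_fun (Suc 0) (\<lambda>xs. min_elem (xs ! 0))"
    by (simp add: min_elem_def)
qed

lemma rec_fun_del_min: "rec_fun n G \<Longrightarrow> rec_fun n (\<lambda>xs. del_min (G xs))"
  unfolding del_min_def by (intro rec_fun_diff rec_fun_power2 rec_fun_min_elem)

text \<open>The first argument is fuel. For each fixed bound the list unfolds into finitely many
  compositions, so recursiveness is shown by induction on the bound and no recursion producing lists
  has to be coded.\<close>

fun elems :: "nat \<Rightarrow> nat \<Rightarrow> nat list" where
  "elems 0 n = []"
| "elems (Suc b) n = (if n = 0 then [] else min_elem n # elems b (del_min n))"

lemma min_elem_in: "n \<noteq> 0 \<Longrightarrow> min_elem n \<in> set_decode n"
  using LeastI_ex[OF min_elem_ex[of n]] unfolding min_elem_def[symmetric]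
  by (auto simp: set_decode_def odd_iff_mod_2_eq_one)

text \<open>A canonical index is the sum of the powers of two over its set; subtracting one summand
  deletes exactly that element.\<close>

lemma set_decode_del_min: "n \<noteq> 0 \<Longrightarrow> set_decode (del_min n) = set_decode n - {min_elem n}"
proof -
  assume "n \<noteq> 0"
  then have "sum ((^) 2) (set_decode n) = 2 ^ min_elem n + sum ((^) 2) (set_decode n - {min_elem n})"
    by (intro sum.remove min_elem_in) auto
  then have "set_encode (set_decode n - {min_elem n}) = del_min n"
    by (metis add_diff_cancel_left' del_min_def set_decode_inverse set_encode_def)
  then show ?thesis by (metis finite_Diff finite_set_decode set_encode_inverse)
qed

lemma set_elems: "card (set_decode n) \<le> b \<Longrightarrow> set (elems b n) = set_decode n"
proof (induction b arbitrary: n)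
  case 0
  then show ?case by simp
next
  case (Suc b)
  show ?case
  proof (cases "n = 0")
    case False
    with Suc.prems have "card (set_decode (del_min n)) \<le> b"
      by (simp add: set_decode_del_min min_elem_in)
    with Suc.IH False show ?thesis
      using min_elem_in[OF False] by (auto simp: set_decode_del_min)
  qed simp
qed

lemma length_elems: "length (elems b n) \<le> b"
  by (induction b arbitrary: n) auto

text \<open>Beyond the end of the list \<open>F\<close> may take any value, so
  \<open>min_elem\<close> after \<open>i\<close> deletions will do, without a test for the
  end.\<close>

lemma rec_fun_elem:
  assumes "rec_fun m G"
  shows "\<exists>F. rec_fun m F \<and> (\<forall>xs. i < length (elems b (G xs)) \<longrightarrow> F xs = elems b (G xs) ! i)"
  using assms
proof (induction i arbitrary: b G)
  case 0
  then show ?case by (intro exI[of _ "\<lambda>xs. min_elem (G xs)"]) (cases b; auto intro: rec_fun_min_elem)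
next
  case (Suc i)
  from Suc.IH[OF rec_fun_del_min[OF Suc.prems], of "b - 1"] obtain F where
    "rec_fun m F" "\<forall>xs. i < length (elems (b - 1) (del_min (G xs))) \<longrightarrow>
      F xs = elems (b - 1) (del_min (G xs)) ! i" by blast
  then show ?case by (intro exI[of _ F]) (cases b; auto)
qed

text \<open>\<open>list_encode\<close> maps the empty list to 0, so the zero branch of
  \<open>rec_fun_if0\<close> already returns the right code.\<close>

lemma rec_fun_labels:
  assumes "rec_fun m G"
  shows "rec_fun m (\<lambda>xs. list_encode (map (\<lambda>x. fst (prod_decode x)) (elems b (G xs))))"
  using assms
proof (induction b arbitrary: G)
  case 0
  then show ?case by (simp add: rec_fun_const)
next
  case (Suc b)
  have "rec_fun m (\<lambda>xs. if G xs = 0 then 0 else Suc (prod_encode (fst (prod_decode (min_elem (G xs))),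
     list_encode (map (\<lambda>x. fst (prod_decode x)) (elems b (del_min (G xs)))))))"
    by (intro rec_fun_if0 rec_fun_Suc rec_fun_prod_encode rec_fun_fst_decode rec_fun_min_elem
        rec_fun_del_min Suc)
  then show ?case
    by (rule back_subst[of "rec_fun m"]) auto
qed

section \<open>Counter programs\<close>

text \<open>\<open>Loop\<close> tests and decrements its register before each pass. It is a counting
  loop if the body leaves that register alone and a while loop if the body recomputes it; primitive
  recursion needs the first, minimization the second.\<close>

datatype com = Inc nat | Dec nat | Seq com com | Loop nat com

inductive exec :: "com \<Rightarrow> (nat \<Rightarrow> nat) \<Rightarrow> (nat \<Rightarrow> nat) \<Rightarrow> bool" where
  exec_Inc: "exec (Inc r) s (s(r := Suc (s r)))"
| exec_Dec: "exec (Dec r) s (s(r := s r - 1))"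
| exec_Seq: "exec c s s' \<Longrightarrow> exec d s' s'' \<Longrightarrow> exec (Seq c d) s s''"
| exec_Loop_0: "s r = 0 \<Longrightarrow> exec (Loop r c) s s"
| exec_Loop_Suc: "s r = Suc n \<Longrightarrow> exec c (s(r := n)) s' \<Longrightarrow> exec (Loop r c) s' s'' \<Longrightarrow>
    exec (Loop r c) s s''"

lemma exec_Inc_eq: "s' = s(r := Suc (s r)) \<Longrightarrow> exec (Inc r) s s'"
  by (simp add: exec_Inc)

lemma exec_Dec_eq: "s' = s(r := s r - 1) \<Longrightarrow> exec (Dec r) s s'"
  using exec_Dec by simp

text \<open>There is no idle command, so the body decrements a second time; since \<open>Dec\<close>
  stops at 0, the result is still 0.\<close>

definition clear :: "nat \<Rightarrow> com" where
  "clear r = Loop r (Dec r)"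

lemma exec_clear: "s' = s(r := 0) \<Longrightarrow> exec (clear r) s s'"
  unfolding clear_def
proof (induction "s r" arbitrary: s s' rule: less_induct)
  case less
  show ?case
  proof (cases "s r")
    case 0
    with less.prems have "s' = s" by auto
    with 0 show ?thesis by (simp add: exec_Loop_0)
  next
    case (Suc n)
    have "exec (Loop r (Dec r)) (s(r := n - 1)) s'"
      by (rule less.hyps) (use Suc less.prems in auto)
    with Suc show ?thesis
      by - (rule exec_Loop_Suc[where s' = "s(r := n - 1)"], auto intro!: exec_Dec_eq)
  qed
qed

definition move :: "nat \<Rightarrow> nat \<Rightarrow> com" where
  "move a b = Loop a (Inc b)"

lemma exec_move: "a \<noteq> b \<Longrightarrow> s' = s(a := 0, b := s b + s a) \<Longrightarrow> exec (move a b) s s'"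
  unfolding move_def
proof (induction "s a" arbitrary: s s')
  case 0
  then have "s' = s" by auto
  with 0 show ?case by (simp add: exec_Loop_0)
next
  case (Suc n)
  have "exec (Loop a (Inc b)) (s(a := n, b := Suc (s b))) s'"
    by (rule Suc.hyps) (use Suc in \<open>auto simp flip: Suc.hyps(2)\<close>)
  with Suc show ?case
    by - (rule exec_Loop_Suc[where s' = "s(a := n, b := Suc (s b))"], auto intro!: exec_Inc_eq)
qed

definition copy :: "nat \<Rightarrow> nat \<Rightarrow> nat \<Rightarrow> com" where
  "copy a b t = Seq (Loop a (Seq (Inc b) (Inc t))) (move t a)"

lemma exec_copy:
  assumes "distinct [a, b, t]" "s t = 0" "s' = s(b := s b + s a)"
  shows "exec (copy a b t) s s'"
proof -
  have "exec (Loop a (Seq (Inc b) (Inc t))) s (s(a := 0, b := s b + s a, t := s t + s a))" for s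
  proof (induction "s a" arbitrary: s)
    case 0
    then have "s(a := 0, b := s b + s a, t := s t + s a) = s" by auto
    with 0 show ?case by (metis exec_Loop_0)
  next
    case (Suc n)
    let ?s = "s(a := n, b := Suc (s b), t := Suc (s t))"
    have eq: "?s(a := 0, b := ?s b + ?s a, t := ?s t + ?s a) = s(a := 0, b := s b + s a, t := s t + s a)"
      using assms by (auto simp: fun_eq_iff simp flip: Suc.hyps(2))
    have "exec (Loop a (Seq (Inc b) (Inc t))) ?s (s(a := 0, b := s b + s a, t := s t + s a))"
      unfolding eq[symmetric] by (rule Suc.hyps(1)) (use assms in auto)
    then show ?case
      using Suc(2) assms
      by - (rule exec_Loop_Suc[where s' = ?s], auto intro!: exec_Seq[OF exec_Inc] exec_Inc_eq)
  qed
  then show ?thesis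
    unfolding copy_def by (rule exec_Seq) (rule exec_move, use assms in auto)
qed

lemma exec_clear_range: "\<exists>c. \<forall>s. exec c s (\<lambda>j. if t \<le> j \<and> j \<le> t + m then 0 else s j)"
proof (induction m)
  case 0
  show ?case by (intro exI[of _ "clear t"] allI exec_clear) auto
next
  case (Suc m)
  then obtain c where c: "\<And>s. exec c s (\<lambda>j. if t \<le> j \<and> j \<le> t + m then 0 else s j)" by blast
  show ?case
    by (intro exI[of _ "Seq c (clear (t + Suc m))"] allI exec_Seq[OF c] exec_clear) auto
qed

section \<open>Compiling recursive functions into structured programs\<close>

inductive_cases evaluates_ZeroE: "evaluates Zero xs y"
inductive_cases evaluates_SuccE: "evaluates Succ xs y"
inductive_cases evaluates_ProjE: "evaluates (Proj i) xs y"
inductive_cases evaluates_CompE: "evaluates (Comp f gs) xs y"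
inductive_cases evaluates_PrimRecE: "evaluates (PrimRec f g) xs y"
inductive_cases evaluates_MuE: "evaluates (Mu f) xs y"

text \<open>\<open>evaluates\<close> unfolds downwards from \<open>n\<close>, whereas the compiled
  loop counts upwards from the base case; the sequence \<open>R\<close> of intermediate values
  connects the two.\<close>

lemma evaluates_PrimRec_trace:
  assumes "evaluates (PrimRec f g) (n # xs) y"
  shows "\<exists>R. R n = y \<and> evaluates f xs (R 0) \<and> (\<forall>j<n. evaluates g (j # R j # xs) (R (Suc j)))"
  using assms
proof (induction n arbitrary: y)
  case 0
  then show ?case by (auto elim!: evaluates_PrimRecE)
next
  case (Suc n)
  from Suc.prems obtain r where "evaluates (PrimRec f g) (n # xs) r" and g: "evaluates g (n # r # xs) y"
    by (auto elim: evaluates_PrimRecE)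
  with Suc.IH obtain R where "R n = r" "evaluates f xs (R 0)" "\<forall>j<n. evaluates g (j # R j # xs) (R (Suc j))"
    by blast
  with g show ?case
    by (intro exI[of _ "R(Suc n := y)"]) (auto simp: less_Suc_eq)
qed

text \<open>All registers from \<open>t\<close> on serve as scratch space: they are required to be \<open>0\<close> and are left
  \<open>0\<close>, so that code can be reused in loops.\<close>

definition computes :: "com \<Rightarrow> recf \<Rightarrow> nat list \<Rightarrow> nat \<Rightarrow> nat \<Rightarrow> bool" where
  "computes c e as r t \<longleftrightarrow> (\<forall>s y. evaluates e (map s as) y \<longrightarrow> s r = 0 \<longrightarrow> (\<forall>j\<ge>t. s j = 0) \<longrightarrow>
     exec c s (s(r := y)))"

lemma computesD:
  "computes c e as r t \<Longrightarrow> evaluates e (map s as) y \<Longrightarrow> s r = 0 \<Longrightarrow> (\<And>j. j \<ge> t \<Longrightarrow> s j = 0) \<Longrightarrow>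
    s' = s(r := y) \<Longrightarrow> exec c s s'"
  unfolding computes_def by blast

text \<open>All programs share one scratch area that lies above the whole block of results, so
  results already obtained survive the later computations.\<close>

lemma computes_list:
  assumes "\<And>i. i < length gs \<Longrightarrow> computes (c i) (gs ! i) as (t + i) (t + length gs)"
    and as: "set as \<subseteq> {..<t}" and "n \<le> length gs"
  shows "\<exists>d. \<forall>s ys. (\<forall>i<n. evaluates (gs ! i) (map s as) (ys ! i)) \<longrightarrow> (\<forall>j\<ge>t. s j = 0) \<longrightarrow>
    exec d s (\<lambda>j. if t \<le> j \<and> j < t + n then ys ! (j - t) else s j)"
  using assms(3)
proof (induction n)
  case 0
  show ?case
    \<comment> \<open>\<open>Dec t\<close> plays the empty program, because register
      \<open>t\<close> holds 0.\<close>
    by (intro exI[of _ "Dec t"] allI impI exec_Dec_eq) auto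
next
  case (Suc n)
  then obtain d where d: "\<And>s ys. \<forall>i<n. evaluates (gs ! i) (map s as) (ys ! i) \<Longrightarrow> \<forall>j\<ge>t. s j = 0 \<Longrightarrow>
    exec d s (\<lambda>j. if t \<le> j \<and> j < t + n then ys ! (j - t) else s j)" by auto
  show ?case
  proof (intro exI[of _ "Seq d (c n)"] allI impI exec_Seq[OF d])
    fix s :: "nat \<Rightarrow> nat" and ys :: "nat list"
    assume *: "\<forall>i<Suc n. evaluates (gs ! i) (map s as) (ys ! i)" "\<forall>j\<ge>t. s j = 0"
    let ?s = "\<lambda>j. if t \<le> j \<and> j < t + n then ys ! (j - t) else s j"
    have "map ?s as = map s as" using as by auto
    then have "evaluates (gs ! n) (map ?s as) (ys ! n)" using *(1) by (simp only: lessI)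
    then show "exec (c n) ?s (\<lambda>j. if t \<le> j \<and> j < t + Suc n then ys ! (j - t) else s j)"
      using *(2) Suc.prems by (intro computesD[OF assms(1)[of n], where y = "ys ! n"]) (auto simp: fun_eq_iff)
  qed auto
qed

lemma computes_Zero:
  assumes prems: "set as \<subseteq> {..<t}" "r < t" "r \<notin> set as"
  shows "\<exists>c. computes c Zero as r t"
proof -
  show ?thesis
    by (rule exI[of _ "Dec r"]) (auto simp: computes_def elim!: evaluates_ZeroE intro!: exec_Dec_eq)
qed

lemma computes_Succ:
  assumes prems: "set as \<subseteq> {..<t}" "r < t" "r \<notin> set as"
  shows "\<exists>c. computes c Succ as r t"
proof -
  have "exec (Seq (copy (hd as) r t) (Inc r)) s (s(r := y))"
    if ev: "evaluates Succ (map s as) y" and z: "s r = 0" "\<forall>j\<ge>t. s j = 0" for s y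
  proof -
    obtain a where a: "as = [a]" "y = Suc (s a)"
      using ev by (auto elim!: evaluates_SuccE)
    show ?thesis
      by (rule exec_Seq[OF exec_copy exec_Inc_eq]) (use z a prems in auto)
  qed
  then show ?thesis by (auto simp: computes_def)
qed

lemma computes_Proj:
  assumes prems: "set as \<subseteq> {..<t}" "r < t" "r \<notin> set as"
  shows "\<exists>c. computes c (Proj i) as r t"
proof -
  have "exec (copy (as ! i) r t) s (s(r := y))"
    if "evaluates (Proj i) (map s as) y" "s r = 0" "\<forall>j\<ge>t. s j = 0" for s y
  proof -
    have a: "i < length as" "y = s (as ! i)"
      using that(1) by (auto elim!: evaluates_ProjE)
    then have "as ! i \<in> set as" by simp
    with prems have "as ! i < t" "as ! i \<noteq> r" by auto
    then show ?thesis
      by (intro exec_copy) (use that a prems in auto)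
  qed
  then show ?thesis by (auto simp: computes_def)
qed

lemma computes_Comp:
  assumes prems: "set as \<subseteq> {..<t}" "r < t" "r \<notin> set as"
    and IH_f: "\<And>as r t. set as \<subseteq> {..<t} \<Longrightarrow> r < t \<Longrightarrow> r \<notin> set as \<Longrightarrow> \<exists>c. computes c f as r t"
    and IH_gs: "\<And>g as r t. g \<in> set gs \<Longrightarrow> set as \<subseteq> {..<t} \<Longrightarrow> r < t \<Longrightarrow> r \<notin> set as \<Longrightarrow> \<exists>c. computes c g as r t"
  shows "\<exists>c. computes c (Comp f gs) as r t"
proof -
  let ?n = "length gs"
  have "\<exists>c. computes c (gs ! i) as (t + i) (t + ?n)" if "i < ?n" for i
    by (rule IH_gs) (use that prems in auto)
  then obtain c where c: "\<And>i. i < ?n \<Longrightarrow> computes (c i) (gs ! i) as (t + i) (t + ?n)"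
    by metis
  obtain d where d: "\<And>s ys. \<forall>i<?n. evaluates (gs ! i) (map s as) (ys ! i) \<Longrightarrow> \<forall>j\<ge>t. s j = 0 \<Longrightarrow>
    exec d s (\<lambda>j. if t \<le> j \<and> j < t + ?n then ys ! (j - t) else s j)"
    using computes_list[of gs c as t ?n] c prems by auto
  have "\<exists>b. computes b f [t..<t + ?n] r (t + ?n)"
    by (rule IH_f) (use prems in auto)
  then obtain b where b: "computes b f [t..<t + ?n] r (t + ?n)" ..
  \<comment> \<open>The cleared range is inclusive and hence never empty; its last register is
    scratch and holds 0 already.\<close>
  obtain w where w: "\<And>s. exec w s (\<lambda>j. if t \<le> j \<and> j \<le> t + ?n then 0 else s j)"
    using exec_clear_range[of t ?n] by blast
  have "exec (Seq d (Seq b w)) s (s(r := y))"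
    if ev: "evaluates (Comp f gs) (map s as) y" and z: "s r = 0" "\<forall>j\<ge>t. s j = 0" for s y
  proof -
    obtain ys where ys: "length ys = ?n" "\<forall>i<?n. evaluates (gs ! i) (map s as) (ys ! i)"
      "evaluates f ys y" using ev by (auto elim!: evaluates_CompE)
    let ?s = "\<lambda>j. if t \<le> j \<and> j < t + ?n then ys ! (j - t) else s j"
    have "map ?s [t..<t + ?n] = ys"
      using ys(1) by (auto intro: nth_equalityI)
    with ys(3) have "exec b ?s (?s(r := y))"
      by (intro computesD[OF b]) (use z prems in auto)
    moreover
    have "(\<lambda>j. if t \<le> j \<and> j \<le> t + ?n then 0 else (?s(r := y)) j) = s(r := y)"
      using z prems by (auto simp: fun_eq_iff)
    then have "exec w (?s(r := y)) (s(r := y))"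
      using w[of "?s(r := y)"] by (simp only:)
    ultimately show ?thesis
      using d[OF ys(2) z(2)] by (intro exec_Seq)
  qed
  then show ?thesis by (auto simp: computes_def)
qed

text \<open>Register \<open>t\<close> counts up as the index passed to \<open>g\<close>,
  \<open>t + 1\<close> counts down as the loop counter, \<open>t + 2\<close> holds the current value
  and \<open>t + 3\<close> the next one. Scratch space begins at \<open>t + 4\<close>.\<close>

lemma computes_PrimRec:
  assumes prems: "set as \<subseteq> {..<t}" "r < t" "r \<notin> set as"
    and IH_f: "\<And>as r t. set as \<subseteq> {..<t} \<Longrightarrow> r < t \<Longrightarrow> r \<notin> set as \<Longrightarrow> \<exists>c. computes c f as r t"
    and IH_g: "\<And>as r t. set as \<subseteq> {..<t} \<Longrightarrow> r < t \<Longrightarrow> r \<notin> set as \<Longrightarrow> \<exists>c. computes c g as r t"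
  shows "\<exists>c. computes c (PrimRec f g) as r t"
proof -
  show ?thesis
  proof (cases as)
    case Nil
    \<comment> \<open>Without an argument to recurse on there is no value, so any program will
      do.\<close>
    then show ?thesis by (auto simp: computes_def elim: evaluates_PrimRecE)
  next
    case (Cons a as')
    have "\<exists>c. computes c f as' (t + 2) (t + 4)" "\<exists>c. computes c g (t # (t + 2) # as') (t + 3) (t + 4)"
      by (rule IH_f IH_g; use prems Cons in auto)+
    then obtain cf cg where cf: "computes cf f as' (t + 2) (t + 4)"
      and cg: "computes cg g (t # (t + 2) # as') (t + 3) (t + 4)" by blast
    define body where "body = Seq cg (Seq (clear (t + 2)) (Seq (move (t + 3) (t + 2)) (Inc t)))"
    have "exec (Seq (copy a (t + 1) (t + 4)) (Seq cf (Seq (Loop (t + 1) body) (Seq (clear t) (move (t + 2) r)))))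
      s (s(r := y))"
      if ev: "evaluates (PrimRec f g) (map s as) y" and z: "s r = 0" "\<forall>j\<ge>t. s j = 0" for s y
    proof -
      have a: "a < t" "a \<noteq> r" "r < t" and fr: "\<And>k v s. k \<ge> t \<Longrightarrow> map (s(k := v)) as' = map s as'"
        using prems Cons by auto
      obtain R where R: "R (s a) = y" "evaluates f (map s as') (R 0)"
        "\<forall>j<s a. evaluates g (j # R j # map s as') (R (Suc j))"
        using evaluates_PrimRec_trace ev Cons by (metis list.simps(9))
      have loop: "exec (Loop (t + 1) body) (s(t := i, t + 1 := m, t + 2 := R i)) (s(t := i + m, t + 2 := R (i + m)))"
        if "i + m = s a" for i m
        using that
      proof (induction m arbitrary: i)
        case 0
        have eq: "s(t := i, t + 1 := 0, t + 2 := R i) = s(t := i, t + 2 := R i)"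
          using z by (auto simp: fun_eq_iff)
        show ?case
          unfolding eq add_0_right by (rule exec_Loop_0) (use z in simp)
      next
        case (Suc m)
        let ?s = "s(t := i, t + 1 := m, t + 2 := R i)"
        have "exec body ?s (s(t := Suc i, t + 1 := m, t + 2 := R (Suc i)))"
          unfolding body_def
        proof (intro exec_Seq)
          show "exec cg ?s (?s(t + 3 := R (Suc i)))"
            by (rule computesD[OF cg, where y = "R (Suc i)"]) (use R Suc.prems z in \<open>auto simp: fr\<close>)
          show "exec (clear (t + 2)) (?s(t + 3 := R (Suc i))) (?s(t + 3 := R (Suc i), t + 2 := 0))"
            by (rule exec_clear) simp
          show "exec (move (t + 3) (t + 2)) (?s(t + 3 := R (Suc i), t + 2 := 0))
            (s(t := i, t + 1 := m, t + 2 := R (Suc i)))"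
            by (rule exec_move) (use z in \<open>auto simp: fun_eq_iff\<close>)
          show "exec (Inc t) (s(t := i, t + 1 := m, t + 2 := R (Suc i)))
            (s(t := Suc i, t + 1 := m, t + 2 := R (Suc i)))"
            by (rule exec_Inc_eq) (auto simp: fun_eq_iff)
        qed
        also have "?s = (s(t := i, t + 1 := Suc m, t + 2 := R i))(t + 1 := m)"
          by (auto simp: fun_eq_iff)
        finally show ?case
          unfolding add_Suc_shift using Suc.IH[of "Suc i"] Suc.prems
          by - (rule exec_Loop_Suc[where n = m], simp, assumption, simp only: add_Suc_shift)
      qed
      show ?thesis
      proof (intro exec_Seq)
        show "exec (copy a (t + 1) (t + 4)) s (s(t + 1 := s a))"
          by (rule exec_copy) (use a z in auto)
        show "exec cf (s(t + 1 := s a)) (s(t := 0, t + 1 := s a, t + 2 := R 0))"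
          by (rule computesD[OF cf, where y = "R 0"]) (use R z in \<open>auto simp: fr fun_eq_iff\<close>)
        show "exec (Loop (t + 1) body) (s(t := 0, t + 1 := s a, t + 2 := R 0)) (s(t := s a, t + 2 := y))"
          using loop[of 0 "s a"] R(1) by simp
        show "exec (clear t) (s(t := s a, t + 2 := y)) (s(t + 2 := y))"
          by (rule exec_clear) (use z in \<open>auto simp: fun_eq_iff\<close>)
        show "exec (move (t + 2) r) (s(t + 2 := y)) (s(r := y))"
          by (rule exec_move) (use a z in \<open>auto simp: fun_eq_iff\<close>)
      qed
    qed
    then show ?thesis by (auto simp: computes_def)
  qed
qed

text \<open>The value of \<open>f\<close> is its own loop guard: \<open>t + 1\<close> holds the
  value at the candidate in \<open>t\<close>, and the loop goes on while it is positive. The test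
  consumes only one unit, so the body clears the remainder before evaluating the next
  candidate.\<close>

lemma computes_Mu:
  assumes prems: "set as \<subseteq> {..<t}" "r < t" "r \<notin> set as"
    and IH_f: "\<And>as r t. set as \<subseteq> {..<t} \<Longrightarrow> r < t \<Longrightarrow> r \<notin> set as \<Longrightarrow> \<exists>c. computes c f as r t"
  shows "\<exists>c. computes c (Mu f) as r t"
proof -
  have "\<exists>c. computes c f (t # as) (t + 1) (t + 2)"
    by (rule IH_f) (use prems in auto)
  then obtain cf where cf: "computes cf f (t # as) (t + 1) (t + 2)" ..
  define body where "body = Seq (clear (t + 1)) (Seq (Inc t) cf)"
  have "exec (Seq cf (Seq (Loop (t + 1) body) (move t r))) s (s(r := n))"
    if ev: "evaluates (Mu f) (map s as) n" and z: "s r = 0" "\<forall>j\<ge>t. s j = 0" for s n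
  proof -
    have fr: "\<And>k v s. k \<ge> t \<Longrightarrow> map (s(k := v)) as = map s as"
      using prems by auto
    from ev have "evaluates f (n # map s as) 0" "\<forall>k<n. \<exists>y>0. evaluates f (k # map s as) y"
      by (auto elim: evaluates_MuE)
    \<comment> \<open>One value per candidate is chosen, with 0 prescribed at \<open>n\<close>; this
      avoids any appeal to uniqueness of values.\<close>
    then have "\<exists>V. \<forall>k. k \<le> n \<longrightarrow> evaluates f (k # map s as) (V k) \<and> (k < n \<longrightarrow> V k > 0) \<and> (k = n \<longrightarrow> V k = 0)"
      by (intro choice) (metis le_neq_implies_less less_irrefl)
    then obtain V where *: "\<forall>k. k \<le> n \<longrightarrow> evaluates f (k # map s as) (V k) \<and>
      (k < n \<longrightarrow> V k > 0) \<and> (k = n \<longrightarrow> V k = 0)" ..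
    then have V: "\<And>k. k \<le> n \<Longrightarrow> evaluates f (k # map s as) (V k)"
      "\<And>k. k < n \<Longrightarrow> V k > 0" "V n = 0"
      using *[rule_format, of n] by auto
    have run: "exec cf (s(t := k)) (s(t := k, t + 1 := V k))" if "k \<le> n" for k
      by (rule computesD[OF cf, where y = "V k"]) (use that V z in \<open>auto simp: fr\<close>)
    have loop: "exec (Loop (t + 1) body) (s(t := k, t + 1 := V k)) (s(t := n))" if "k \<le> n" for k
      using that
    proof (induction k rule: inc_induct)
      case base
      have eq: "s(t := n, t + 1 := V n) = s(t := n)" using z V by (auto simp: fun_eq_iff)
      show ?case unfolding eq by (rule exec_Loop_0) (use z in simp)
    next
      case (step k)
      obtain v where v: "V k = Suc v" using V(2)[OF step.hyps(2)] gr0_implies_Suc by blast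
      have "exec body (s(t := k, t + 1 := v)) (s(t := Suc k, t + 1 := V (Suc k)))"
        unfolding body_def
      proof (intro exec_Seq)
        show "exec (clear (t + 1)) (s(t := k, t + 1 := v)) (s(t := k))"
          by (rule exec_clear) (use z in \<open>auto simp: fun_eq_iff\<close>)
        show "exec (Inc t) (s(t := k)) (s(t := Suc k))"
          by (rule exec_Inc_eq) auto
        show "exec cf (s(t := Suc k)) (s(t := Suc k, t + 1 := V (Suc k)))"
          by (rule run) (use step.hyps in simp)
      qed
      also have "s(t := k, t + 1 := v) = (s(t := k, t + 1 := V k))(t + 1 := v)"
        by (auto simp: fun_eq_iff)
      finally show ?case
        using v step.IH by - (rule exec_Loop_Suc[where n = v], simp)
    qed
    show ?thesis
    proof (intro exec_Seq)
      have "s(t := 0) = s" using z by auto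
      with run[of 0] show "exec cf s (s(t := 0, t + 1 := V 0))" by simp
      show "exec (Loop (t + 1) body) (s(t := 0, t + 1 := V 0)) (s(t := n))"
        by (rule loop) simp
      show "exec (move t r) (s(t := n)) (s(r := n))"
        by (rule exec_move) (use prems z in \<open>auto simp: fun_eq_iff\<close>)
    qed
  qed
  then show ?thesis by (auto simp: computes_def)
qed

lemma computes_ex:
  "set as \<subseteq> {..<t} \<Longrightarrow> r < t \<Longrightarrow> r \<notin> set as \<Longrightarrow> \<exists>c. computes c e as r t"
proof (induction e arbitrary: as r t)
  case (Comp f gs)
  show ?case using Comp.prems by (rule computes_Comp) (rule Comp.IH; assumption)+
next
  case (PrimRec f g)
  show ?case using PrimRec.prems by (rule computes_PrimRec) (rule PrimRec.IH; assumption)+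
next
  case (Mu f)
  show ?case using Mu.prems by (rule computes_Mu) (rule Mu.IH; assumption)
qed (rule computes_Zero computes_Succ computes_Proj; assumption)+

section \<open>Translating structured programs into jump code\<close>

datatype instr = INC nat nat | DJZ nat nat nat

fun csize :: "com \<Rightarrow> nat" where
  "csize (Inc r) = 1"
| "csize (Dec r) = 1"
| "csize (Seq c d) = csize c + csize d"
| "csize (Loop r c) = Suc (csize c)"

text \<open>\<open>a\<close> is the address at which the code is placed and \<open>x\<close> the
  address at which to continue. A loop body continues at the test \<open>a\<close>. Since all
  successor addresses are explicit, a program stops by jumping outside its code.\<close>

fun flat :: "com \<Rightarrow> nat \<Rightarrow> nat \<Rightarrow> instr list" where
  "flat (Inc r) a x = [INC r x]"
| "flat (Dec r) a x = [DJZ r x x]"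
| "flat (Seq c d) a x = flat c a (a + csize c) @ flat d (a + csize c) x"
| "flat (Loop r c) a x = DJZ r (Suc a) x # flat c (Suc a) a"

lemma length_flat: "length (flat c a x) = csize c"
  by (induction c arbitrary: a x) auto

inductive_set cstep :: "instr list \<Rightarrow> ((nat \<times> (nat \<Rightarrow> nat)) \<times> (nat \<times> (nat \<Rightarrow> nat))) set"
  for P where
  INC: "p < length P \<Longrightarrow> P ! p = INC r x \<Longrightarrow> ((p, s), (x, s(r := Suc (s r)))) \<in> cstep P"
| DJZ_0: "p < length P \<Longrightarrow> P ! p = DJZ r x y \<Longrightarrow> s r = 0 \<Longrightarrow> ((p, s), (y, s)) \<in> cstep P"
| DJZ_Suc: "p < length P \<Longrightarrow> P ! p = DJZ r x y \<Longrightarrow> s r = Suc n \<Longrightarrow> ((p, s), (x, s(r := n))) \<in> cstep P"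

definition code_at :: "instr list \<Rightarrow> nat \<Rightarrow> instr list \<Rightarrow> bool" where
  "code_at P a is \<longleftrightarrow> (\<exists>us vs. P = us @ is @ vs \<and> length us = a)"

lemma code_at_append:
  assumes "code_at P a (is @ js)"
  shows "code_at P a is \<and> code_at P (a + length is) js"
proof -
  obtain us vs where "P = us @ (is @ js) @ vs" "length us = a"
    using assms by (auto simp only: code_at_def)
  then have "P = us @ is @ (js @ vs) \<and> length us = a"
    "P = (us @ is) @ js @ vs \<and> length (us @ is) = a + length is" by simp_all
  then show ?thesis unfolding code_at_def by blast
qed

lemma code_at_Cons:
  assumes "code_at P a (i # is)"
  shows "a < length P \<and> P ! a = i \<and> code_at P (Suc a) is"
proof -
  obtain us vs where "P = us @ (i # is) @ vs" "length us = a"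
    using assms by (auto simp only: code_at_def)
  then have "a < length P" "P ! a = i" by auto
  then show ?thesis
    using code_at_append[of P a "[i]" "is"] assms by simp
qed

lemma flat_exec:
  "exec c s s' \<Longrightarrow> code_at P a (flat c a x) \<Longrightarrow> ((a, s), (x, s')) \<in> (cstep P)\<^sup>*"
proof (induction arbitrary: a x rule: exec.induct)
  case (exec_Inc r s)
  then have "a < length P" "P ! a = INC r x" by (auto dest: code_at_Cons)
  then show ?case by (intro r_into_rtrancl cstep.INC)
next
  case (exec_Dec r s)
  then have P: "a < length P" "P ! a = DJZ r x x" by (auto dest: code_at_Cons)
  show ?case
  proof (cases "s r")
    case 0
    have "((a, s), (x, s)) \<in> cstep P" by (rule cstep.DJZ_0[where r = r]) fact+
    with 0 show ?thesis by (simp add: fun_upd_idem r_into_rtrancl)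
  next
    case (Suc n)
    have "((a, s), (x, s(r := n))) \<in> cstep P" by (rule cstep.DJZ_Suc) fact+
    moreover have "s(r := s r - 1) = s(r := n)" using Suc by simp
    ultimately show ?thesis by (simp only: r_into_rtrancl)
  qed
next
  case (exec_Seq c s s' d s'')
  then show ?case
    by (fastforce dest: code_at_append simp: length_flat intro: rtrancl_trans)
next
  case (exec_Loop_0 s r c)
  then show ?case by (auto dest!: code_at_Cons intro!: r_into_rtrancl cstep.DJZ_0)
next
  case (exec_Loop_Suc s r n c s' s'')
  then have "((a, s), (Suc a, s(r := n))) \<in> cstep P"
    by (auto dest!: code_at_Cons intro!: cstep.DJZ_Suc)
  moreover have "((Suc a, s(r := n)), (a, s')) \<in> (cstep P)\<^sup>*"
    using exec_Loop_Suc.IH(1) exec_Loop_Suc.prems by (simp only: flat.simps) (blast dest: code_at_Cons)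
  moreover have "((a, s'), (x, s'')) \<in> (cstep P)\<^sup>*"
    using exec_Loop_Suc by auto
  ultimately show ?case by (meson converse_rtrancl_into_rtrancl rtrancl_trans)
qed

fun blocks :: "com list \<Rightarrow> nat \<Rightarrow> instr list" where
  "blocks [] a = []"
| "blocks (c # cs) a = flat c a 0 @ blocks cs (a + csize c)"

lemma blocks_code_at:
  "code_at P a (blocks cs a) \<Longrightarrow> i < length cs \<Longrightarrow> \<exists>b. code_at P b (flat (cs ! i) b 0)"
proof (induction cs arbitrary: a i)
  case (Cons c cs)
  then show ?case
    by (cases i) (auto dest!: code_at_append simp: length_flat)
qed simp

section \<open>Simulating counters on a tape\<close>

text \<open>Register \<open>r\<close> is held in unary on the cells \<open>r, k + r, 2k + r, \<dots>\<close>. The head rests at cell \<open>0\<close>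
  between instructions; to return there it walks left in strides of \<open>k\<close> until it reads a blank,
  which is cell \<open>r - k\<close>, so that no end marker is needed. The last argument of a control state
  counts the moves made in the current stride; \<open>Back\<close> and \<open>Home\<close> carry the register and the next
  instruction.\<close>

datatype ctl = Seek nat nat | Jump nat nat | Pull nat nat | Back nat nat nat | Home nat nat nat

instance ctl :: countable
  by countable_datatype

fun reg :: "instr \<Rightarrow> nat" where
  "reg (INC r x) = r"
| "reg (DJZ r x y) = r"

fun targets :: "instr \<Rightarrow> nat set" where
  "targets (INC r x) = {x}"
| "targets (DJZ r x y) = {x, y}"

text \<open>The return walk for register \<open>r\<close> reads the blank at cell
  \<open>r - k\<close> and already moves right on it; \<open>Suc r < k\<close> leaves at least one
  further move before cell 0, on which \<open>Home\<close> can switch to \<open>Seek\<close>. The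
  condition \<open>1 < k\<close> is this inequality for register 0, whose return walk is also used
  when a menu is left.\<close>

locale tracks =
  fixes k :: nat and P :: "instr list" and V :: "nat set"
  assumes k: "1 < k"
    and reg: "i \<in> set P \<Longrightarrow> Suc (reg i) < k"
    and targets: "i \<in> set P \<Longrightarrow> targets i \<subseteq> V"
    and fin: "finite V"
begin

text \<open>The end of a unary track is recognized only on its first blank. \<open>INC\<close> marks
  that blank, while \<open>DJZ\<close> must \<open>Pull\<close> one stride back to erase the last
  mark. \<open>Seek p j\<close> has no move for \<open>p\<close> beyond the program: such states are
  the exits.\<close>

fun delta :: "ctl \<Rightarrow> bool \<Rightarrow> (bool \<times> dir \<times> ctl) option" where
  "delta (Seek p j) b = (if p < length P then
     if j < reg (P ! p) then Some (b, MoveR, Seek p (Suc j))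
     else if j = reg (P ! p) then
       if b then Some (True, MoveR, Jump p 1)
       else (case P ! p of INC r x \<Rightarrow> Some (True, MoveL, Back r x 1)
             | DJZ r x y \<Rightarrow> Some (False, MoveL, Back r y 1))
     else None else None)"
| "delta (Jump p j) b = (if p < length P then
     if j < k then Some (b, MoveR, Jump p (Suc j))
     else if j = k then
       if b then Some (True, MoveR, Jump p 1)
       else (case P ! p of INC r x \<Rightarrow> Some (True, MoveL, Back r x 1)
             | DJZ r x y \<Rightarrow> Some (False, MoveL, Pull p 1))
     else None else None)"
| "delta (Pull p j) b = (if p < length P then
     if j < k then Some (b, MoveL, Pull p (Suc j))
     else if j = k then
       (case P ! p of INC r x \<Rightarrow> None | DJZ r x y \<Rightarrow> Some (False, MoveL, Back r x 1))
     else None else None)"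
| "delta (Back r x j) b = (if x \<in> V \<and> Suc r < k then
     if j < k then Some (b, MoveL, Back r x (Suc j))
     else if j = k then Some (b, if b then (MoveL, Back r x 1) else (MoveR, Home r x 1))
     else None else None)"
| "delta (Home r x j) b = (if x \<in> V \<and> Suc r < k \<and> j < k - r then
     Some (b, MoveR, if Suc j < k - r then Home r x (Suc j) else Seek x 0) else None)"

text \<open>Here the tape is fixed and the head position \<open>h\<close> varies, so that registers
  have absolute addresses.\<close>

definition mstep :: "((ctl \<times> (int \<Rightarrow> bool) \<times> int) \<times> (ctl \<times> (int \<Rightarrow> bool) \<times> int)) set" where
  "mstep = {((q, f, h), (q', f(h := b), h + shift X)) | q f h q' b X. delta q (f h) = Some (b, X, q')}"

lemma mstepI:
  "delta q (f h) = Some (b, X, q') \<Longrightarrow> f' = f(h := b) \<Longrightarrow> h' = h + shift X \<Longrightarrow>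
    ((q, f, h), (q', f', h')) \<in> mstep"
  by (auto simp: mstep_def)

lemma mstep_moves:
  assumes "\<And>i b. i < n \<Longrightarrow> delta (q i) b = Some (b, X, q (Suc i))"
  shows "((q 0, f, h), (q n, f, h + int n * shift X)) \<in> mstep\<^sup>*"
  using assms
proof (induction n)
  case (Suc n)
  have "((q n, f, h + int n * shift X), (q (Suc n), f, h + int (Suc n) * shift X)) \<in> mstep"
    by (rule mstepI[OF Suc.prems[of n]]) (auto simp: algebra_simps)
  with Suc show ?case by (meson less_Suc_eq rtrancl.rtrancl_into_rtrancl)
qed simp

section \<open>Arithmetic of the interleaved tracks\<close>

definition track :: "(nat \<Rightarrow> nat) \<Rightarrow> int \<Rightarrow> bool" where
  "track s p \<longleftrightarrow> 0 \<le> p \<and> p div int k < int (s (nat (p mod int k)))"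

definition pos :: "nat \<Rightarrow> int \<Rightarrow> int" where
  "pos r j = int k * j + int r"

text \<open>\<open>j\<close> ranges over all integers in order to include -1: that cell is always
  blank and ends the walk home.\<close>

lemma track_pos: "r < k \<Longrightarrow> track s (pos r j) \<longleftrightarrow> 0 \<le> j \<and> j < int (s r)"
proof -
  assume r: "r < k"
  then have "pos r j div int k = j" "pos r j mod int k = int r"
    by (simp_all add: pos_def)
  moreover have "0 \<le> pos r j \<longleftrightarrow> 0 \<le> j"
    using r calculation(1) pos_imp_zdiv_nonneg_iff[of "int k" "pos r j"] by simp
  ultimately show ?thesis by (simp add: track_def)
qed

lemma pos_surj: "\<exists>r j. r < k \<and> p = pos r j"
  using k by (intro exI[of _ "nat (p mod int k)"] exI[of _ "p div int k"])
    (simp add: pos_def nat_less_iff)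

lemma pos_inject: "r < k \<Longrightarrow> r' < k \<Longrightarrow> pos r j = pos r' j' \<longleftrightarrow> r = r' \<and> j = j'"
proof
  assume *: "r < k" "r' < k" "pos r j = pos r' j'"
  then have "pos r j div int k = pos r' j' div int k" "pos r j mod int k = pos r' j' mod int k"
    by simp_all
  with *(1,2) show "r = r' \<and> j = j'" by (simp add: pos_def)
qed simp

lemma track_Suc: "r < k \<Longrightarrow> track (s(r := Suc (s r))) = (track s)(pos r (int (s r)) := True)"
proof
  fix p assume r: "r < k"
  obtain r' j where p: "r' < k" "p = pos r' j" using pos_surj by blast
  with r show "track (s(r := Suc (s r))) p = ((track s)(pos r (int (s r)) := True)) p"
    by (auto simp: track_pos pos_inject)
qed

lemma track_dec: "r < k \<Longrightarrow> s r = Suc n \<Longrightarrow> track (s(r := n)) = (track s)(pos r (int n) := False)"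
proof
  fix p assume r: "r < k" "s r = Suc n"
  obtain r' j where p: "r' < k" "p = pos r' j" using pos_surj by blast
  with r show "track (s(r := n)) p = ((track s)(pos r (int n) := False)) p"
    by (auto simp: track_pos pos_inject)
qed

lemma finite_track: "finite {p. track s p}"
proof (rule finite_subset)
  show "{p. track s p} \<subseteq> (\<Union>r<k. (\<lambda>j. pos r (int j)) ` {..<s r})"
  proof
    fix p assume p: "p \<in> {p. track s p}"
    obtain r j where rj: "r < k" "p = pos r j" using pos_surj by blast
    with p have "0 \<le> j" "j < int (s r)" by (auto simp: track_pos)
    with rj show "p \<in> (\<Union>r<k. (\<lambda>j. pos r (int j)) ` {..<s r})"
      by (intro UN_I[of r] image_eqI[of _ _ "nat j"]) auto
  qed
qed auto

section \<open>Walks of the head\<close>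

lemma home:
  assumes "Suc r < k" "x \<in> V"
  shows "((Home r x 1, f, int r + 1 - int k), (Seek x 0, f, 0)) \<in> mstep\<^sup>*"
proof -
  \<comment> \<open>From cell \<open>r + 1 - k\<close> it takes \<open>n\<close> moves to reach cell
    -1; the move after that enters \<open>Seek\<close>.\<close>
  define n where "n = k - r - 2"
  have n: "k - r = Suc (Suc n)" "int k = int r + int n + 2" using assms by (simp_all add: n_def)
  have "((Home r x (Suc 0), f, int r + 1 - int k), (Home r x (Suc n), f, int r + 1 - int k + int n * shift MoveR)) \<in> mstep\<^sup>*"
    by (rule mstep_moves[where q = "\<lambda>i. Home r x (Suc i)"]) (use assms n in auto)
  also have "int r + 1 - int k + int n * shift MoveR = - 1"
    by (simp add: shift_def n)
  also have "((Home r x (Suc n), f, - 1), (Seek x 0, f, 0)) \<in> mstep"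
    by (rule mstepI[where b = "f (- 1)" and X = MoveR]) (use assms n in \<open>auto simp: shift_def\<close>)
  finally show ?thesis by simp
qed

lemma back_from:
  assumes "Suc r < k" "x \<in> V"
  shows "((Back r x 1, f, pos r j - 1), (Back r x k, f, pos r (j - 1))) \<in> mstep\<^sup>*"
proof -
  have "((Back r x (Suc 0), f, pos r j - 1), (Back r x (Suc (k - 1)), f, pos r j - 1 + int (k - 1) * shift MoveL)) \<in> mstep\<^sup>*"
    by (rule mstep_moves[where q = "\<lambda>i. Back r x (Suc i)"]) (use assms in auto)
  moreover have "pos r j - 1 + int (k - 1) * shift MoveL = pos r (j - 1)" "Suc (k - 1) = k"
    using k by (auto simp: shift_def pos_def algebra_simps)
  ultimately show ?thesis by simp
qed

text \<open>\<open>j \<le> s r\<close> makes every cell of the track below index \<open>j\<close>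
  marked, so the walk cannot stop early. The walk may thus start from a cell just marked, just
  erased or found blank; the offset -1 is the first move of the stride, made by the preceding
  step.\<close>

lemma go_home:
  assumes r: "Suc r < k" "x \<in> V" and "j \<le> s r"
  shows "((Back r x 1, track s, pos r (int j) - 1), (Seek x 0, track s, 0)) \<in> mstep\<^sup>*"
  using assms(3)
proof (induction j)
  case 0
  have nt: "\<not> track s (pos r (- 1))" using r by (simp add: track_pos)
  have "((Back r x k, track s, pos r (- 1)), (Home r x 1, track s, int r + 1 - int k)) \<in> mstep"
    by (rule mstepI[where b = False and X = MoveR]) (use assms nt in \<open>auto simp: shift_def pos_def fun_upd_idem\<close>)
  moreover have "((Back r x 1, track s, pos r (int 0) - 1), (Back r x k, track s, pos r (- 1))) \<in> mstep\<^sup>*"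
    using back_from[OF r, of "track s" 0] by simp
  ultimately show ?case
    using home[OF r] by (meson rtrancl_trans r_into_rtrancl)
next
  case (Suc j)
  have "((Back r x k, track s, pos r (int j)), (Back r x 1, track s, pos r (int j) - 1)) \<in> mstep"
    by (rule mstepI[where b = True and X = MoveL]) (use assms Suc in \<open>auto simp: shift_def track_pos fun_upd_idem\<close>)
  moreover have "((Back r x 1, track s, pos r (int (Suc j)) - 1), (Back r x k, track s, pos r (int j))) \<in> mstep\<^sup>*"
    using back_from[OF r, of "track s" "int (Suc j)"] by simp
  moreover have "((Back r x 1, track s, pos r (int j) - 1), (Seek x 0, track s, 0)) \<in> mstep\<^sup>*"
    using Suc by simp
  ultimately show ?case by (meson rtrancl_trans r_into_rtrancl)
qed

lemma seek:
  assumes "p < length P" "reg (P ! p) = r"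
  shows "((Seek p 0, f, 0), (Seek p r, f, pos r 0)) \<in> mstep\<^sup>*"
proof -
  have "((Seek p 0, f, 0), (Seek p r, f, 0 + int r * shift MoveR)) \<in> mstep\<^sup>*"
    by (rule mstep_moves[where q = "Seek p"]) (use assms in auto)
  then show ?thesis by (simp add: shift_def pos_def)
qed

lemma jump_from:
  assumes "p < length P"
  shows "((Jump p 1, f, pos r j + 1), (Jump p k, f, pos r (j + 1))) \<in> mstep\<^sup>*"
proof -
  have "((Jump p (Suc 0), f, pos r j + 1), (Jump p (Suc (k - 1)), f, pos r j + 1 + int (k - 1) * shift MoveR)) \<in> mstep\<^sup>*"
    by (rule mstep_moves[where q = "\<lambda>i. Jump p (Suc i)"]) (use assms in auto)
  moreover have "pos r j + 1 + int (k - 1) * shift MoveR = pos r (j + 1)" "Suc (k - 1) = k"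
    using k by (auto simp: shift_def pos_def algebra_simps)
  ultimately show ?thesis by simp
qed

lemma jump:
  assumes "p < length P" "r < k" "j < s r"
  shows "((Jump p 1, track s, pos r (int j) + 1), (Jump p k, track s, pos r (int (s r)))) \<in> mstep\<^sup>*"
  using assms(3)
proof (induction "s r - j" arbitrary: j)
  case (Suc n)
  show ?case
  proof (cases "Suc j = s r")
    case True
    then show ?thesis using jump_from[OF assms(1), of "track s" r "int j"] by (simp add: add.commute flip: True)
  next
    case False
    with Suc have j: "Suc j < s r" by simp
    have "((Jump p k, track s, pos r (int (Suc j))), (Jump p 1, track s, pos r (int (Suc j)) + 1)) \<in> mstep"
      by (rule mstepI[where b = True and X = MoveR]) (use assms j in \<open>auto simp: shift_def track_pos fun_upd_idem simp del: of_nat_Suc\<close>)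
    moreover have "((Jump p 1, track s, pos r (int j) + 1), (Jump p k, track s, pos r (int (Suc j)))) \<in> mstep\<^sup>*"
      using jump_from[OF assms(1), of "track s" r "int j"] by (simp add: add.commute)
    moreover have "((Jump p 1, track s, pos r (int (Suc j)) + 1), (Jump p k, track s, pos r (int (s r)))) \<in> mstep\<^sup>*"
      by (rule Suc(1)) (use Suc(2) j in auto)
    ultimately show ?thesis by (meson rtrancl_trans r_into_rtrancl)
  qed
qed simp

lemma pull:
  assumes "p < length P"
  shows "((Pull p 1, f, pos r j - 1), (Pull p k, f, pos r (j - 1))) \<in> mstep\<^sup>*"
proof -
  have "((Pull p (Suc 0), f, pos r j - 1), (Pull p (Suc (k - 1)), f, pos r j - 1 + int (k - 1) * shift MoveL)) \<in> mstep\<^sup>*"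
    by (rule mstep_moves[where q = "\<lambda>i. Pull p (Suc i)"]) (use assms in auto)
  moreover have "pos r j - 1 + int (k - 1) * shift MoveL = pos r (j - 1)" "Suc (k - 1) = k"
    using k by (auto simp: shift_def pos_def algebra_simps)
  ultimately show ?thesis by simp
qed

lemma scan:
  assumes "p < length P" "reg (P ! p) = r" "s r \<noteq> 0"
  shows "((Seek p 0, track s, 0), (Jump p k, track s, pos r (int (s r)))) \<in> mstep\<^sup>*"
proof -
  have r: "r < k" using assms reg by (metis Suc_lessD nth_mem)
  have "((Seek p r, track s, pos r 0), (Jump p 1, track s, pos r 0 + 1)) \<in> mstep"
    by (rule mstepI[where b = True and X = MoveR])
      (use assms r in \<open>auto simp: shift_def track_pos fun_upd_idem\<close>)
  moreover have "((Jump p 1, track s, pos r 0 + 1), (Jump p k, track s, pos r (int (s r)))) \<in> mstep\<^sup>*"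
    using jump[OF assms(1) r, of 0 s] assms(3) by simp
  ultimately show ?thesis
    using seek[OF assms(1,2)] by (meson rtrancl_trans r_into_rtrancl)
qed

lemma cstep_mstep:
  "((p, s), (x, s')) \<in> cstep P \<Longrightarrow> ((Seek p 0, track s, 0), (Seek x 0, track s', 0)) \<in> mstep\<^sup>*"
proof (erule cstep.cases, goal_cases)
  case (1 p' r x' s0)
  then have p: "p < length P" "P ! p = INC r x" "s' = s(r := Suc (s r))" by auto
  have r: "Suc r < k" "x \<in> V" using p reg[of "P ! p"] targets[of "P ! p"] nth_mem[OF p(1)] by auto
  \<comment> \<open>An empty register shows its first blank to \<open>Seek\<close>, a nonempty one
    to \<open>Jump\<close>; both states make the same move there.\<close>
  have *: "\<exists>q. ((Seek p 0, track s, 0), (q, track s, pos r (int (s r)))) \<in> mstep\<^sup>* \<and>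
      delta q False = Some (True, MoveL, Back r x 1)"
  proof (cases "s r = 0")
    case True
    then show ?thesis using seek[OF p(1), of r] p by (intro exI[of _ "Seek p r"]) auto
  next
    case False
    then show ?thesis using scan[OF p(1), of r s] p by (intro exI[of _ "Jump p k"]) auto
  qed
  then obtain q where q: "((Seek p 0, track s, 0), (q, track s, pos r (int (s r)))) \<in> mstep\<^sup>*"
    "delta q False = Some (True, MoveL, Back r x 1)" by blast
  have "((q, track s, pos r (int (s r))), (Back r x 1, track s', pos r (int (s r)) - 1)) \<in> mstep"
    by (rule mstepI[where b = True and X = MoveL]) (use p q r in \<open>auto simp: shift_def track_pos track_Suc\<close>)
  moreover have "((Back r x 1, track s', pos r (int (s r)) - 1), (Seek x 0, track s', 0)) \<in> mstep\<^sup>*"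
    by (rule go_home[OF r]) (use p in simp)
  ultimately show ?case using q(1) by (meson rtrancl_trans r_into_rtrancl)
next
  case (2 p' r x' y s0)
  then have p: "p < length P" "P ! p = DJZ r x' x" "s' = s" "s r = 0" by auto
  have r: "Suc r < k" "x \<in> V" using p reg[of "P ! p"] targets[of "P ! p"] nth_mem[OF p(1)] by auto
  have "((Seek p r, track s, pos r 0), (Back r x 1, track s, pos r (int 0) - 1)) \<in> mstep"
    by (rule mstepI[where b = False and X = MoveL]) (use p r in \<open>auto simp: shift_def track_pos fun_upd_idem\<close>)
  moreover have "((Seek p 0, track s, 0), (Seek p r, track s, pos r 0)) \<in> mstep\<^sup>*"
    by (rule seek[OF p(1)]) (use p in simp)
  moreover have "((Back r x 1, track s, pos r (int 0) - 1), (Seek x 0, track s, 0)) \<in> mstep\<^sup>*"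
    by (rule go_home[OF r]) simp
  ultimately show ?case unfolding p(3) by (meson rtrancl_trans r_into_rtrancl)
next
  case (3 p' r x' y s0 n)
  then have p: "p < length P" "P ! p = DJZ r x y" "s' = s(r := n)" "s r = Suc n" by auto
  have r: "Suc r < k" "x \<in> V" using p reg[of "P ! p"] targets[of "P ! p"] nth_mem[OF p(1)] by auto
  have a: "((Jump p k, track s, pos r (int (Suc n))), (Pull p 1, track s, pos r (int (Suc n)) - 1)) \<in> mstep"
    by (rule mstepI[where b = False and X = MoveL])
      (use p r in \<open>auto simp: shift_def track_pos fun_upd_idem simp del: of_nat_Suc\<close>)
  have b: "((Pull p 1, track s, pos r (int (Suc n)) - 1), (Pull p k, track s, pos r (int n))) \<in> mstep\<^sup>*"
    using pull[OF p(1), of "track s" r "int (Suc n)"] by simp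
  have c: "((Pull p k, track s, pos r (int n)), (Back r x 1, track s', pos r (int n) - 1)) \<in> mstep"
    by (rule mstepI[where b = False and X = MoveL])
      (use p r in \<open>auto simp: shift_def track_dec\<close>)
  have d: "((Back r x 1, track s', pos r (int n) - 1), (Seek x 0, track s', 0)) \<in> mstep\<^sup>*"
    by (rule go_home[OF r]) (use p in auto)
  have e: "((Seek p 0, track s, 0), (Jump p k, track s, pos r (int (Suc n)))) \<in> mstep\<^sup>*"
    using scan[OF p(1), of r s] p by simp
  show ?case
    using e a b c d by (meson rtrancl_trans r_into_rtrancl)
qed

lemma csteps_msteps:
  "((p, s), (x, s')) \<in> (cstep P)\<^sup>* \<Longrightarrow> ((Seek p 0, track s, 0), (Seek x 0, track s', 0)) \<in> mstep\<^sup>*"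
  by (induction p s rule: converse_rtrancl_induct2) (auto dest: cstep_mstep intro: rtrancl_trans)

text \<open>\<open>ctl\<close> is an infinite type; the range checks in \<open>delta\<close> are
  what makes the machine finite.\<close>

definition dom_delta :: "ctl set" where
  "dom_delta = {q. \<exists>b. delta q b \<noteq> None}"

lemma finite_dom_delta: "finite dom_delta"
proof (rule finite_subset)
  have r: "p < length P \<Longrightarrow> reg (P ! p) \<le> k" for p
    using reg[of "P ! p"] by simp
  show "dom_delta \<subseteq> case_prod Seek ` ({..<length P} \<times> {..k}) \<union> case_prod Jump ` ({..<length P} \<times> {..k}) \<union>
    case_prod Pull ` ({..<length P} \<times> {..k}) \<union> (\<lambda>(r, x, j). Back r x j) ` ({..k} \<times> V \<times> {..k}) \<union>
    (\<lambda>(r, x, j). Home r x j) ` ({..k} \<times> V \<times> {..k})"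
  proof
    fix q assume "q \<in> dom_delta"
    then obtain b where "delta q b \<noteq> None" by (auto simp: dom_delta_def)
    then show "q \<in> case_prod Seek ` ({..<length P} \<times> {..k}) \<union> case_prod Jump ` ({..<length P} \<times> {..k}) \<union>
      case_prod Pull ` ({..<length P} \<times> {..k}) \<union> (\<lambda>(r, x, j). Back r x j) ` ({..k} \<times> V \<times> {..k}) \<union>
      (\<lambda>(r, x, j). Home r x j) ` ({..k} \<times> V \<times> {..k})"
      using r by (cases q) (auto split: if_splits simp: image_iff intro: less_imp_le order_trans)
  qed
qed (use fin in auto)

end

section \<open>A machine offering menus\<close>

lemma mk_tape_in_tapes:
  assumes "set l \<subseteq> with_blank D" "d \<in> with_blank D" "set r \<subseteq> with_blank D"
  shows "mk_tape l d r \<in> tapes D"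
proof -
  have "set l \<union> {d} \<union> set r \<subseteq> with_blank D" using assms by simp
  then show ?thesis unfolding tapes_def by blast
qed

lemma ex_tape_cell:
  assumes "finite {i. g i \<noteq> None}" "range g \<subseteq> with_blank D"
  shows "\<exists>\<tau>\<in>tapes D. cell \<tau> = g"
proof -
  have "finite ((\<lambda>i. nat \<bar>i\<bar>) ` {i. g i \<noteq> None})" using assms(1) by simp
  then obtain n where "\<forall>m\<in>(\<lambda>i. nat \<bar>i\<bar>) ` {i. g i \<noteq> None}. m \<le> n"
    unfolding finite_nat_set_iff_bounded_le by blast
  then have n: "g i = None" if "\<bar>i\<bar> > int n" for i using that by fastforce
  let ?l = "map (\<lambda>i. g (- 1 - int i)) [0..<n]" and ?r = "map (\<lambda>i. g (1 + int i)) [0..<n]"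
  have "cell (mk_tape (rev ?l) (g 0) ?r) = g"
  proof
    fix i show "cell (mk_tape (rev ?l) (g 0) ?r) i = g i"
      using n[of i] by (auto simp: cell_mk_tape nth_blank_def)
  qed
  moreover have "mk_tape (rev ?l) (g 0) ?r \<in> tapes D"
    using assms(2) by (intro mk_tape_in_tapes) auto
  ultimately show ?thesis by blast
qed

lemma rtm_steps_tapes:
  assumes "reactive_turing_machine A D M" "((s, \<tau>), a, (t, \<tau>')) \<in> rtm_steps D M"
  shows "\<tau> \<in> tapes D \<and> \<tau>' \<in> tapes D"
proof -
  have blank: "None \<in> with_blank D" by (simp add: with_blank_def)
  have wf: "d \<in> with_blank D \<and> e \<in> with_blank D" if "(s, d, a, e, X, t) \<in> rules M" for s d a e X t
    using assms(1) that unfolding reactive_turing_machine_def by blast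
  have last: "mark_last l w \<in> tapes D" if "set l \<union> set w \<subseteq> with_blank D" for l w
    using that blank by (cases l rule: rev_cases) (auto simp: mark_last_def intro!: mk_tape_in_tapes)
  have first: "mark_first w r \<in> tapes D" if "set w \<union> set r \<subseteq> with_blank D" for w r
    using that blank by (cases r) (auto simp: mark_first_def intro!: mk_tape_in_tapes)
  from assms(2) show ?thesis
    by cases (auto dest!: wf intro!: mk_tape_in_tapes last first)
qed

text \<open>The rules speak of representatives of tapes. As \<open>cell\<close> is injective, an
  equation between cell functions determines the new tape, and no representative has to be chosen
  again.\<close>

lemma rtm_steps_iff:
  assumes M: "reactive_turing_machine A D M"
  shows "((s, \<tau>), a, (t, \<tau>')) \<in> rtm_steps D M \<longleftrightarrow> \<tau> \<in> tapes D \<and>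
    (\<exists>e X. (s, cell \<tau> 0, a, e, X, t) \<in> rules M \<and> cell \<tau>' = (\<lambda>i. ((cell \<tau>)(0 := e)) (i + shift X)))"
    (is "?lhs \<longleftrightarrow> ?rhs")
proof
  assume ?lhs
  then show ?rhs
  proof cases
    case (left d e l r)
    then have "cell \<tau> 0 = d" by (simp add: cell_mk_tape)
    with left have "(s, cell \<tau> 0, a, e, MoveL, t) \<in> rules M"
      "cell \<tau>' = (\<lambda>i. ((cell \<tau>)(0 := e)) (i + shift MoveL))"
      by (simp_all only: cell_mark_last[of l e r d])
    then show ?thesis using rtm_steps_tapes[OF M \<open>?lhs\<close>] by blast
  next
    case (right d e l r)
    then have "cell \<tau> 0 = d" by (simp add: cell_mk_tape)
    with right have "(s, cell \<tau> 0, a, e, MoveR, t) \<in> rules M"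
      "cell \<tau>' = (\<lambda>i. ((cell \<tau>)(0 := e)) (i + shift MoveR))"
      by (simp_all only: cell_mark_first[of l e r d])
    then show ?thesis using rtm_steps_tapes[OF M \<open>?lhs\<close>] by blast
  qed
next
  assume ?rhs
  then obtain e X l d r where r: "(s, cell \<tau> 0, a, e, X, t) \<in> rules M"
    and c: "cell \<tau>' = (\<lambda>i. ((cell \<tau>)(0 := e)) (i + shift X))"
    and \<tau>: "\<tau> = mk_tape l d r" "set l \<union> {d} \<union> set r \<subseteq> with_blank D"
    by (auto simp: tapes_def)
  have d: "cell \<tau> 0 = d" by (simp add: \<tau> cell_mk_tape)
  show ?lhs
  proof (cases X)
    case MoveL
    with c \<tau> have "\<tau>' = mark_last l (e # r)"
      by (simp add: cell_mark_last[of l e r d] flip: cell_inject)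
    with r d MoveL \<tau> rtm_steps.left[of s d a e t M l r D] show ?thesis by simp
  next
    case MoveR
    with c \<tau> have "\<tau>' = mark_first (l @ [e]) r"
      by (simp add: cell_mark_first[of l e r d] flip: cell_inject)
    with r d MoveR \<tau> rtm_steps.right[of s d a e t M l r D] show ?thesis by simp
  qed
qed

text \<open>Entering instruction \<open>length P + j\<close> stops the program: the control state then offers the
  actions of \<open>menu j\<close>, each paired with the instruction at which the program resumes. Leaving a
  menu with \<open>MoveL\<close> puts the head on cell \<open>- 1\<close>, one step before the end of the return walk of
  register \<open>0\<close>.\<close>

locale menu_machine = tracks k P V for k P V +
  fixes A :: "'a set" and D :: "'d set" and d0 :: 'd and K :: nat
    and menu :: "nat \<Rightarrow> ('a act \<times> nat) set" and acc :: "nat \<Rightarrow> bool" and e0 :: nat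
  assumes d0: "d0 \<in> D"
    and menu: "j < K \<Longrightarrow> finite (menu j) \<and> menu j \<subseteq> act_tau A \<times> V"
begin

definition symb :: "bool \<Rightarrow> 'd option" where
  "symb b = (if b then Some d0 else None)"

definition enc :: "ctl \<Rightarrow> nat" where
  "enc = to_nat"

definition menu_state :: "nat \<Rightarrow> ctl" where
  "menu_state j = Seek (length P + j) 0"

definition tau_rules :: "(nat \<times> 'd option \<times> 'a act \<times> 'd option \<times> dir \<times> nat) set" where
  "tau_rules = {(enc q, symb b, Tau, symb b', X, enc q') | q b b' X q'. delta q b = Some (b', X, q')}"

definition menu_rules :: "(nat \<times> 'd option \<times> 'a act \<times> 'd option \<times> dir \<times> nat) set" where
  "menu_rules = {(enc (menu_state j), symb b, a, symb b, MoveL, enc (Home 0 x (k - 1))) | j b a x.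
     j < K \<and> (a, x) \<in> menu j}"

definition machine :: "(nat, 'a, 'd) rtm" where
  "machine = \<lparr>
     control = insert (enc (Seek e0 0)) ((enc \<circ> menu_state) ` {..<K} \<union>
       (\<Union>(q, d, a, e, X, q') \<in> tau_rules \<union> menu_rules. {q, q'})),
     rules = tau_rules \<union> menu_rules,
     start = enc (Seek e0 0),
     accepting = (enc \<circ> menu_state) ` {j. j < K \<and> acc j}\<rparr>"

lemma enc_inject [simp]: "enc q = enc q' \<longleftrightarrow> q = q'"
  by (simp add: enc_def)

lemma symb_inject [simp]: "symb b = symb b' \<longleftrightarrow> b = b'"
  by (simp add: symb_def)

lemma symb_in: "symb b \<in> with_blank D"
  using d0 by (simp add: symb_def with_blank_def)

lemma delta_menu_state [simp]: "delta (menu_state j) b = None"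
  by (simp add: menu_state_def)

lemma finite_rules: "finite (tau_rules \<union> menu_rules)"
proof -
  have "tau_rules \<subseteq> (\<lambda>(q, b). case delta q b of Some (b', X, q') \<Rightarrow> (enc q, symb b, Tau, symb b', X, enc q'))
      ` (dom_delta \<times> UNIV)"
  proof
    fix x assume "x \<in> tau_rules"
    then obtain q b b' X q' where x: "x = (enc q, symb b, Tau, symb b', X, enc q')" "delta q b = Some (b', X, q')"
      by (auto simp: tau_rules_def)
    then have "q \<in> dom_delta" unfolding dom_delta_def by (auto intro: exI[of _ b])
    with x show "x \<in> (\<lambda>(q, b). case delta q b of Some (b', X, q') \<Rightarrow> (enc q, symb b, Tau, symb b', X, enc q'))
      ` (dom_delta \<times> UNIV)"
      by (intro image_eqI[of _ _ "(q, b)"]) auto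
  qed
  moreover have "menu_rules \<subseteq> (\<lambda>(j, b, a, x). (enc (menu_state j), symb b, a, symb b, MoveL, enc (Home 0 x (k - 1))))
      ` (SIGMA j:{..<K}. UNIV \<times> menu j)"
    by (force simp: menu_rules_def image_iff)
  ultimately show ?thesis
    using finite_dom_delta menu
    by (intro finite_UnI) (erule finite_subset, force intro!: finite_cartesian_product finite_SigmaI)+
qed

lemma machine_rtm: "reactive_turing_machine A D machine"
proof -
  have "finite (control machine)"
    using finite_rules by (auto simp: machine_def)
  moreover have "rules machine \<subseteq> control machine \<times> with_blank D \<times> act_tau A \<times> with_blank D \<times> UNIV \<times> control machine"
  proof
    fix x assume x: "x \<in> rules machine"
    obtain q d a e X q' where eq: "x = (q, d, a, e, X, q')" by (cases x)
    with x have "(q, d, a, e, X, q') \<in> tau_rules \<union> menu_rules"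
      by (simp add: machine_def)
    then have "q \<in> (\<Union>(q, d, a, e, X, q') \<in> tau_rules \<union> menu_rules. {q, q'})"
      "q' \<in> (\<Union>(q, d, a, e, X, q') \<in> tau_rules \<union> menu_rules. {q, q'})"
      by (rule UN_I, simp)+
    then have "q \<in> control machine" "q' \<in> control machine"
      by (simp_all add: machine_def)
    moreover have "d \<in> with_blank D" "e \<in> with_blank D" "a \<in> act_tau A"
      using x eq menu by (auto simp: machine_def tau_rules_def menu_rules_def symb_in act_tau_def)
    ultimately show "x \<in> control machine \<times> with_blank D \<times> act_tau A \<times> with_blank D \<times> UNIV \<times> control machine"
      by (simp add: eq)
  qed
  ultimately show ?thesis
    by (auto simp: reactive_turing_machine_def machine_def)
qed

section \<open>Head runs as forced runs of the machine\<close>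

abbreviation TM :: "(nat \<times> 'd tape, 'a) ts" where
  "TM \<equiv> rtm_ts D machine"

text \<open>The absolute tape \<open>f\<close> is translated by \<open>h\<close> to put the head at
  0. Injectivity of \<open>cell\<close> makes the choice unique, and finitely many marks make it
  possible.\<close>

definition tape_at :: "(int \<Rightarrow> bool) \<Rightarrow> int \<Rightarrow> 'd tape" where
  "tape_at f h = (SOME \<tau>. \<tau> \<in> tapes D \<and> cell \<tau> = (\<lambda>i. symb (f (i + h))))"

lemma tape_at:
  assumes "finite {p. f p}"
  shows "tape_at f h \<in> tapes D \<and> cell (tape_at f h) = (\<lambda>i. symb (f (i + h)))"
  unfolding tape_at_def
proof (rule someI_ex, rule ex_tape_cell[unfolded Bex_def])
  have "{i. symb (f (i + h)) \<noteq> None} \<subseteq> (\<lambda>p. p - h) ` {p. f p}"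
  proof
    fix i assume "i \<in> {i. symb (f (i + h)) \<noteq> None}"
    then show "i \<in> (\<lambda>p. p - h) ` {p. f p}"
      by (intro image_eqI[of _ _ "i + h"]) (auto simp: symb_def split: if_splits)
  qed
  then show "finite {i. symb (f (i + h)) \<noteq> None}"
    using assms finite_surj by blast
qed (use symb_in in auto)

fun conf :: "ctl \<times> (int \<Rightarrow> bool) \<times> int \<Rightarrow> nat \<times> 'd tape" where
  "conf (q, f, h) = (enc q, tape_at f h)"

lemma machine_step_iff:
  assumes f: "finite {p. f p}"
  shows "(conf (q, f, h), a, c) \<in> transitions TM \<longleftrightarrow>
    (\<exists>b X q'. (enc q, symb (f h), a, symb b, X, enc q') \<in> tau_rules \<union> menu_rules \<and>
       c = conf (q', f(h := b), h + shift X))"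
proof -
  have cells: "cell \<tau> = (\<lambda>i. ((cell (tape_at f h))(0 := symb b)) (i + shift X)) \<longleftrightarrow> \<tau> = tape_at (f(h := b)) (h + shift X)"
    for \<tau> b X
  proof -
    have "finite {p. (f(h := b)) p}"
      by (rule finite_subset[of _ "insert h {p. f p}"]) (use f in auto)
    then have "cell (tape_at (f(h := b)) (h + shift X)) = (\<lambda>i. ((cell (tape_at f h))(0 := symb b)) (i + shift X))"
      using tape_at[OF f, of h] tape_at[of "f(h := b)" "h + shift X"] by (auto simp: fun_eq_iff algebra_simps)
    then show ?thesis by (metis cell_inject)
  qed
  have form: "\<exists>b q'. e = symb b \<and> t = enc q'" if "(s, d, a, e, X, t) \<in> tau_rules \<union> menu_rules" for s d a e X t
    using that by (auto simp: tau_rules_def menu_rules_def)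
  obtain t \<tau> where c: "c = (t, \<tau>)" by (cases c)
  have "(conf (q, f, h), a, c) \<in> transitions TM \<longleftrightarrow>
    (\<exists>e X. (enc q, symb (f h), a, e, X, t) \<in> tau_rules \<union> menu_rules \<and>
       cell \<tau> = (\<lambda>i. ((cell (tape_at f h))(0 := e)) (i + shift X)))"
    using tape_at[OF f, of h] by (simp add: c rtm_ts_def rtm_steps_iff[OF machine_rtm]) (simp add: machine_def)
  also have "\<dots> \<longleftrightarrow> (\<exists>b X q'. (enc q, symb (f h), a, symb b, X, enc q') \<in> tau_rules \<union> menu_rules \<and>
       t = enc q' \<and> cell \<tau> = (\<lambda>i. ((cell (tape_at f h))(0 := symb b)) (i + shift X)))"
    using form by blast
  finally show ?thesis by (simp only: cells c conf.simps prod.inject)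
qed

lemma enc_tau_rules: "(enc q, symb b, a, symb b', X, enc q') \<in> tau_rules \<longleftrightarrow> a = Tau \<and> delta q b = Some (b', X, q')"
  by (auto simp: tau_rules_def)

lemma enc_menu_rules: "(enc q, symb b, a, symb b', X, enc q') \<in> menu_rules \<longleftrightarrow>
    (\<exists>j x. q = menu_state j \<and> j < K \<and> (a, x) \<in> menu j \<and> b' = b \<and> X = MoveL \<and> q' = Home 0 x (k - 1))"
  by (auto simp: menu_rules_def)

lemma conf_menu_step_iff:
  assumes "finite {p. f p}" "j < K"
  shows "(conf (menu_state j, f, h), a, c) \<in> transitions TM \<longleftrightarrow>
    (\<exists>x. (a, x) \<in> menu j \<and> c = conf (Home 0 x (k - 1), f, h - 1))"
proof -
  have "menu_state j = menu_state i \<longleftrightarrow> i = j" for i by (auto simp: menu_state_def)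
  then show ?thesis
    unfolding machine_step_iff[OF assms(1)] Un_iff enc_tau_rules enc_menu_rules
    using assms(2) by (auto simp: shift_def)
qed

text \<open>Such a step is forced because \<open>delta\<close> is a function, menu rules start only
  in menu states, where \<open>delta\<close> is undefined, and only menu states accept.\<close>

lemma mstep_det_tau:
  assumes "((q, f, h), (q', f', h')) \<in> mstep" "finite {p. f p}"
  shows "(conf (q, f, h), conf (q', f', h')) \<in> det_tau TM"
proof -
  from assms(1) obtain b X where d: "delta q (f h) = Some (b, X, q')" and f': "f' = f(h := b)" "h' = h + shift X"
    by (auto simp: mstep_def)
  from d have "\<And>j. q \<noteq> menu_state j" by auto
  with d f' show ?thesis
    unfolding det_tau_def machine_step_iff[OF assms(2)] Un_iff enc_tau_rules enc_menu_rules mem_Collect_eq case_prod_conv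
    by (auto simp: rtm_ts_def machine_def)
qed

lemma msteps_det_tau:
  assumes "((q, f, h), (q', f', h')) \<in> mstep\<^sup>*" "finite {p. f p}"
  shows "(conf (q, f, h), conf (q', f', h')) \<in> (det_tau TM)\<^sup>*"
proof -
  have "(conf c, conf c') \<in> (det_tau TM)\<^sup>* \<and> finite {p. fst (snd c') p}"
    if "(c, c') \<in> mstep\<^sup>*" "finite {p. fst (snd c) p}" for c c'
    using that
  proof (induction rule: rtrancl_induct)
    case (step c1 c2)
    obtain q1 f1 h1 where c1: "c1 = (q1, f1, h1)" by (cases c1)
    obtain q2 f2 h2 where c2: "c2 = (q2, f2, h2)" by (cases c2)
    have f1: "finite {p. f1 p}" and s: "(conf c, conf c1) \<in> (det_tau TM)\<^sup>*"
      using step c1 by auto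
    obtain b where "f2 = f1(h1 := b)" using step.hyps(2) by (auto simp: c1 c2 mstep_def)
    then have "finite {p. f2 p}"
      by - (rule finite_subset[of _ "insert h1 {p. f1 p}"], use f1 in auto)
    moreover have "(conf c1, conf c2) \<in> det_tau TM"
      using mstep_det_tau[OF _ f1] step.hyps(2) by (simp only: c1 c2)
    ultimately show ?case using s c2 by (auto intro: rtrancl_into_rtrancl)
  qed auto
  from this[of "(q, f, h)" "(q', f', h')"] assms show ?thesis by simp
qed

lemma csteps_det_tau:
  "((p, s), (x, s')) \<in> (cstep P)\<^sup>* \<Longrightarrow>
    (conf (Seek p 0, track s, 0), conf (Seek x 0, track s', 0)) \<in> (det_tau TM)\<^sup>*"
  by (intro msteps_det_tau csteps_msteps finite_track)

lemma choice_det_tau: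
  assumes "x \<in> V"
  shows "(conf (Home 0 x (k - 1), track s, - 1), conf (Seek x 0, track s, 0)) \<in> (det_tau TM)\<^sup>*"
proof (intro msteps_det_tau finite_track r_into_rtrancl)
  show "((Home 0 x (k - 1), track s, - 1), (Seek x 0, track s, 0)) \<in> mstep"
    by (rule mstepI[where b = "track s (- 1)" and X = MoveR]) (use k assms in \<open>auto simp: shift_def\<close>)
qed

text \<open>What remains to be supplied is a counter program: \<open>\<rho> s\<close> is the
  register content while the menu of \<open>s\<close> is offered, and each entry must lead from
  there to the exit for some successor.\<close>

lemma menu_machine_bisimilar:
  fixes T :: "('s, 'a) ts"
  assumes T: "transition_system A T"
    and mn: "\<And>s. s \<in> states T \<Longrightarrow> mn s < K"
    and acc: "\<And>s. s \<in> states T \<Longrightarrow> acc (mn s) \<longleftrightarrow> s \<in> finals T"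
    and fwd: "\<And>s a t. (s, a, t) \<in> transitions T \<Longrightarrow>
      \<exists>x. (a, x) \<in> menu (mn s) \<and> ((x, \<rho> s), (length P + mn t, \<rho> t)) \<in> (cstep P)\<^sup>*"
    and bwd: "\<And>s a x. s \<in> states T \<Longrightarrow> (a, x) \<in> menu (mn s) \<Longrightarrow>
      \<exists>t. (s, a, t) \<in> transitions T \<and> ((x, \<rho> s), (length P + mn t, \<rho> t)) \<in> (cstep P)\<^sup>*"
    and init: "((e0, \<lambda>_. 0), (length P + mn (initial T), \<rho> (initial T))) \<in> (cstep P)\<^sup>*"
  shows "dp_branching_bisimilar T TM"
proof (rule dp_bisimilar_by_det_tau[where rdy = "\<lambda>s. conf (menu_state (mn s), track (\<rho> s), 0)", OF T])
  show "transitions TM \<subseteq> states TM \<times> UNIV \<times> states TM"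
  proof
    fix x assume x: "x \<in> transitions TM"
    obtain s \<tau> a t \<tau>' where eq: "x = ((s, \<tau>), a, (t, \<tau>'))" by (metis prod.exhaust)
    then have *: "((s, \<tau>), a, (t, \<tau>')) \<in> rtm_steps D machine" using x by (simp add: rtm_ts_def)
    then obtain d e X where "(s, d, a, e, X, t) \<in> rules machine" by cases auto
    then have "s \<in> control machine \<and> t \<in> control machine"
      using machine_rtm unfolding reactive_turing_machine_def by blast
    with rtm_steps_tapes[OF machine_rtm *] show "x \<in> states TM \<times> UNIV \<times> states TM"
      by (simp add: eq rtm_ts_def)
  qed
  show "conf (menu_state (mn s), track (\<rho> s), 0) \<in> states TM" if "s \<in> states T" for s
    using mn[OF that] tape_at[OF finite_track] by (auto simp: rtm_ts_def machine_def)
  show "conf (menu_state (mn s), track (\<rho> s), 0) \<in> finals TM \<longleftrightarrow> s \<in> finals T" if "s \<in> states T" for s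
    using mn[OF that] acc[OF that] tape_at[OF finite_track]
    by (auto simp: rtm_ts_def machine_def image_iff menu_state_def)
  have run: "(conf (Home 0 x (k - 1), track (\<rho> s), - 1), conf (menu_state (mn t), track (\<rho> t), 0)) \<in> (det_tau TM)\<^sup>*"
    if "((x, \<rho> s), (length P + mn t, \<rho> t)) \<in> (cstep P)\<^sup>*" "x \<in> V" for x s t
    using choice_det_tau[OF that(2)] csteps_det_tau[OF that(1)]
    unfolding menu_state_def by (rule rtrancl_trans)
  show "\<exists>c. (conf (menu_state (mn s), track (\<rho> s), 0), a, c) \<in> transitions TM \<and>
      (c, conf (menu_state (mn t), track (\<rho> t), 0)) \<in> (det_tau TM)\<^sup>*"
    if st: "(s, a, t) \<in> transitions T" for s a t
  proof -
    from st T have "s \<in> states T" by (auto simp: transition_system_def)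
    then have mns: "mn s < K" by (rule mn)
    obtain x where x: "(a, x) \<in> menu (mn s)" "((x, \<rho> s), (length P + mn t, \<rho> t)) \<in> (cstep P)\<^sup>*"
      using fwd[OF st] by blast
    with menu[OF mns] have "x \<in> V" by blast
    with run[OF x(2)] x(1) show ?thesis
      unfolding conf_menu_step_iff[OF finite_track mns] by auto
  qed
  show "\<exists>t. (s, a, t) \<in> transitions T \<and> (c, conf (menu_state (mn t), track (\<rho> t), 0)) \<in> (det_tau TM)\<^sup>*"
    if s: "s \<in> states T" and c: "(conf (menu_state (mn s), track (\<rho> s), 0), a, c) \<in> transitions TM" for s a c
  proof -
    obtain x where x: "(a, x) \<in> menu (mn s)" "c = conf (Home 0 x (k - 1), track (\<rho> s), - 1)"
      using c unfolding conf_menu_step_iff[OF finite_track mn[OF s]] by auto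
    with menu[OF mn[OF s]] have "x \<in> V" by blast
    with bwd[OF s x(1)] run x(2) show ?thesis by blast
  qed
  have "0 < int k" using k by simp
  then have "\<not> track (\<lambda>_. 0) p" for p
    by (auto simp: track_def not_less pos_imp_zdiv_nonneg_iff)
  moreover have "cell (tape_at (track (\<lambda>_. 0)) 0) = (\<lambda>i. symb (track (\<lambda>_. 0) (i + 0)))"
    using tape_at[OF finite_track] by blast
  ultimately have "cell (tape_at (track (\<lambda>_. 0)) 0) = cell (mk_tape [] None [])"
    by (auto simp only: cell_mk_tape symb_def fun_eq_iff triple_cell.simps) simp_all
  then have "tape_at (track (\<lambda>_. 0)) 0 = mk_tape [] None []"
    by (simp only: cell_inject)
  then have "initial TM = conf (Seek e0 0, track (\<lambda>_. 0), 0)"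
    by (simp add: rtm_ts_def machine_def)
  with csteps_det_tau[OF init]
  show "(initial TM, conf (menu_state (mn (initial T)), track (\<rho> (initial T)), 0)) \<in> (det_tau TM)\<^sup>*"
    by (simp add: menu_state_def)
qed

end

section \<open>Menus of a transition system\<close>

text \<open>\<open>e\<close> maps the code of a state to that of the next one, and \<open>g\<close>
  maps the latter to its menu number. The old code is erased in between, so that only the new code
  and its menu number remain.\<close>

lemma block_ex:
  "\<exists>c. \<forall>m y z. evaluates e [m] y \<longrightarrow> evaluates g [y] z \<longrightarrow>
     exec c ((\<lambda>_. 0)(0 := m)) ((\<lambda>_. 0)(0 := y, 1 := z))"
proof -
  obtain ce where ce: "computes ce e [0] 2 3"
    using computes_ex[of "[0]" 3 2 e] by auto
  obtain cg where cg: "computes cg g [0] 1 2"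
    using computes_ex[of "[0]" 2 1 g] by auto
  let ?z = "\<lambda>_. 0 :: nat"
  have "exec (Seq ce (Seq (clear 0) (Seq (move 2 0) cg))) (?z(0 := m)) (?z(0 := y, 1 := z))"
    if "evaluates e [m] y" "evaluates g [y] z" for m y z
  proof (intro exec_Seq)
    show "exec ce (?z(0 := m)) (?z(0 := m, 2 := y))"
      by (rule computesD[OF ce, where y = y]) (use that in auto)
    show "exec (clear 0) (?z(0 := m, 2 := y)) (?z(2 := y))"
      by (rule exec_clear) auto
    show "exec (move 2 0) (?z(2 := y)) (?z(0 := y))"
      by (rule exec_move) auto
    show "exec cg (?z(0 := y)) (?z(0 := y, 1 := z))"
      by (rule computesD[OF cg, where y = z]) (use that in auto)
  qed
  then show ?thesis by blast
qed

text \<open>A run entering at address 0 reaches instruction \<open>j\<close> after subtracting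
  \<open>j\<close> from register 1, so a zero found there reveals the original value. This moves a
  number from the registers into the address.\<close>

definition chain :: "nat \<Rightarrow> nat \<Rightarrow> instr list" where
  "chain K L = map (\<lambda>j. DJZ 1 (Suc j) (L + j)) [0..<K]"

lemma chain_run:
  assumes "j + z < K"
  shows "((j, s(1 := z)), (L + (j + z), s(1 := 0))) \<in> (cstep (chain K L @ is))\<^sup>*"
  using assms
proof (induction z arbitrary: j)
  case 0
  have "((j, s(1 := 0)), (L + j, s(1 := 0))) \<in> cstep (chain K L @ is)"
    by (rule cstep.DJZ_0[where r = 1 and x = "Suc j"]) (use 0 in \<open>auto simp: chain_def nth_append\<close>)
  then show ?case unfolding add_0_right by (rule r_into_rtrancl)
next
  case (Suc z)
  have "((j, s(1 := Suc z)), (Suc j, (s(1 := Suc z))(1 := z))) \<in> cstep (chain K L @ is)"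
    by (rule cstep.DJZ_Suc[where y = "L + j"]) (use Suc.prems in \<open>auto simp: chain_def nth_append\<close>)
  moreover have "((Suc j, s(1 := z)), (L + (Suc j + z), s(1 := 0))) \<in> (cstep (chain K L @ is))\<^sup>*"
    by (rule Suc.IH) (use Suc.prems in simp)
  ultimately show ?case
    unfolding fun_upd_upd add_Suc_shift by (rule converse_rtrancl_into_rtrancl)
qed

lemma length_blocks: "length (blocks cs a) = sum_list (map csize cs)"
  by (induction cs arbitrary: a) (auto simp: length_flat)

text \<open>Every block ends by jumping to address \<open>0\<close>, where the chain converts the value of register
  \<open>1\<close> into a program exit.\<close>

lemma dispatcher_ex:
  fixes es :: "recf list" and g :: recf and K :: nat
  shows "\<exists>P ent. \<forall>i<length es. \<forall>m y z. evaluates (es ! i) [m] y \<longrightarrow> evaluates g [y] z \<longrightarrow> z < K \<longrightarrow>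
    ((ent i, (\<lambda>_. 0)(0 := m)), (length P + z, (\<lambda>_. 0)(0 := y))) \<in> (cstep P)\<^sup>*"
proof -
  obtain blk where blk: "\<And>e m y z. evaluates e [m] y \<Longrightarrow> evaluates g [y] z \<Longrightarrow>
     exec (blk e) ((\<lambda>_. 0)(0 := m)) ((\<lambda>_. 0)(0 := y, 1 := z))"
    using block_ex[of _ g] by metis
  define cs where "cs = map blk es"
  \<comment> \<open>The chain refers to the length of the whole program; this is not circular,
    because code sizes do not depend on addresses.\<close>
  define L where "L = K + sum_list (map csize cs)"
  define P where "P = chain K L @ blocks cs K"
  have L: "length P = L" by (simp add: P_def L_def chain_def length_blocks)
  have "code_at P K (blocks cs K)"
    unfolding code_at_def P_def by (intro exI[of _ "chain K L"] exI[of _ "[]"]) (simp add: chain_def)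
  from blocks_code_at[OF this] have "\<exists>b. code_at P b (flat (cs ! i) b 0)" if "i < length es" for i
    using that by (auto simp: cs_def)
  then obtain ent where ent: "\<And>i. i < length es \<Longrightarrow> code_at P (ent i) (flat (cs ! i) (ent i) 0)"
    by metis
  show ?thesis
  proof (rule exI[of _ P], rule exI[of _ ent], intro allI impI)
    fix i m y z assume i: "i < length es" and ev: "evaluates (es ! i) [m] y" "evaluates g [y] z" and z: "z < K"
    have "((ent i, (\<lambda>_. 0)(0 := m)), (0, (\<lambda>_. 0)(0 := y, 1 := z))) \<in> (cstep P)\<^sup>*"
      by (rule flat_exec[OF _ ent[OF i]]) (use i blk[OF ev] in \<open>simp add: cs_def\<close>)
    moreover have "((0, (\<lambda>_. 0)(0 := y, 1 := z)), (L + (0 + z), (\<lambda>_. 0)(0 := y, 1 := 0))) \<in> (cstep P)\<^sup>*"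
      unfolding P_def by (rule chain_run) (use z in simp)
    moreover have "(\<lambda>_ :: nat. 0 :: nat)(0 := y, 1 := 0) = (\<lambda>_. 0)(0 := y)"
      by (auto simp: fun_eq_iff)
    ultimately show "((ent i, (\<lambda>_. 0)(0 := m)), (length P + z, (\<lambda>_. 0)(0 := y))) \<in> (cstep P)\<^sup>*"
      unfolding L by (metis add_0 rtrancl_trans)
  qed
qed

lemma tracks_ex:
  assumes "finite W"
  shows "\<exists>k. tracks k P (W \<union> (\<Union>(targets ` set P)))"
proof -
  have "reg i < Suc (Max (insert 0 (reg ` set P)))" if "i \<in> set P" for i
    using that by (simp add: less_Suc_eq_le)
  moreover have "finite (targets i)" for i by (cases i) auto
  ultimately show ?thesis
    \<comment> \<open>The inserted 0 covers a program without instructions, and the two successors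
      secure \<open>1 < k\<close>.\<close>
    using assms by (intro exI[of _ "Suc (Suc (Max (insert 0 (reg ` set P))))"]) (unfold_locales, auto)
qed

section \<open>Successor lists and menu numbers\<close>

definition succ_list :: "nat \<Rightarrow> ('a act \<Rightarrow> nat) \<Rightarrow> ('s \<Rightarrow> nat) \<Rightarrow> ('s, 'a) ts \<Rightarrow> 's \<Rightarrow> nat list" where
  "succ_list B codeA codeS T s = elems B (out_code codeA codeS T s)"

text \<open>There are at most \<open>B\<close> codes of transitions, so cutting \<open>elems\<close>
  off at length \<open>B\<close> loses none.\<close>

lemma set_succ_list:
  assumes "branching_degree_le T B" "s \<in> states T"
  shows "set (succ_list B codeA codeS T s) = (\<lambda>(a, t). prod_encode (codeA a, codeS t)) ` out T s"
proof -
  let ?X = "(\<lambda>(a, t). prod_encode (codeA a, codeS t)) ` out T s"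
  have f: "finite (out T s)" and "card (out T s) \<le> B"
    using assms by (auto simp: branching_degree_le_def)
  with card_image_le[OF f] have "card ?X \<le> B" by (meson le_trans)
  then show ?thesis
    using f by (simp add: succ_list_def set_elems out_code_def)
qed

text \<open>Labels are kept with repetitions and in the order of \<open>succ_list\<close>: the
  position of a label identifies a successor, whose code can be computed from the current
  one.\<close>

definition menu_code :: "nat \<Rightarrow> ('a act \<Rightarrow> nat) \<Rightarrow> ('s \<Rightarrow> nat) \<Rightarrow> ('s, 'a) ts \<Rightarrow> 's \<Rightarrow> nat" where
  "menu_code B codeA codeS T s = prod_encode (if s \<in> finals T then 1 else 0,
     list_encode (map (\<lambda>x. fst (prod_decode x)) (succ_list B codeA codeS T s)))"

text \<open>There are finitely many lists of length at most \<open>B\<close> over the finitely many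
  action codes; codes of states do not enter.\<close>

lemma menu_code_bounded:
  assumes "finite A" "transition_system A T" "branching_degree_le T B"
  shows "\<exists>K. \<forall>s\<in>states T. menu_code B codeA codeS T s < K"
proof -
  let ?L = "{xs. set xs \<subseteq> codeA ` act_tau A \<and> length xs \<le> B}"
  have "finite ?L"
    using assms(1) by (intro finite_lists_length_le) (simp add: act_tau_def)
  then have fin: "finite (prod_encode ` ({0, 1} \<times> list_encode ` ?L))" by simp
  then obtain K where K: "\<forall>n\<in>prod_encode ` ({0, 1} \<times> list_encode ` ?L). n < K"
    unfolding finite_nat_set_iff_bounded by blast
  have mem: "menu_code B codeA codeS T s \<in> prod_encode ` ({0, 1} \<times> list_encode ` ?L)" if s: "s \<in> states T" for s
  proof -
    have "fst ` out T s \<subseteq> act_tau A"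
      using assms(2) by (auto simp: transition_system_def out_def)
    then have "set (map (\<lambda>x. fst (prod_decode x)) (succ_list B codeA codeS T s)) \<subseteq> codeA ` act_tau A"
      by (fastforce simp: set_succ_list[OF assms(3) s])
    then have "map (\<lambda>x. fst (prod_decode x)) (succ_list B codeA codeS T s) \<in> ?L"
      using length_elems by (simp add: succ_list_def)
    then show ?thesis by (auto simp: menu_code_def)
  qed
  show ?thesis
    by (intro exI[of _ K] ballI K[rule_format] mem)
qed

lemma menu_code_evaluates:
  assumes "computable codeA codeS T"
  shows "\<exists>g. \<forall>s\<in>states T. evaluates g [codeS s] (menu_code B codeA codeS T s)"
proof -
  obtain eo where eo: "\<forall>s\<in>states T. evaluates eo [codeS s] (out_code codeA codeS T s)"
    using assms by (auto simp: computable_def recursive_wrt_def)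
  obtain ef where ef: "\<forall>s\<in>states T. evaluates ef [codeS s] (if s \<in> finals T then 1 else 0)"
    using assms unfolding computable_def recursive_wrt_def by blast
  let ?G = "\<lambda>f n. prod_encode (f, list_encode (map (\<lambda>x. fst (prod_decode x)) (elems B n)))"
  have "rec_fun 2 (\<lambda>xs. ?G (xs ! 0) (xs ! 1))"
    by (intro rec_fun_prod_encode rec_fun_labels rec_fun_nth) auto
  then obtain g where "\<forall>xs. length xs = 2 \<longrightarrow> evaluates g xs (?G (xs ! 0) (xs ! 1))"
    unfolding rec_fun_def by blast
  then have g: "evaluates g [f, n] (?G f n)" for f n
    by (elim allE[of _ "[f, n]"]) simp
  have "evaluates (Comp g [ef, eo]) [codeS s] (menu_code B codeA codeS T s)" if s: "s \<in> states T" for s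
    unfolding menu_code_def succ_list_def
    by (rule evaluates.comp[OF _ _ g]) (use s eo ef in \<open>auto simp: less_Suc_eq nth_Cons split: nat.split\<close>)
  then show ?thesis by blast
qed

lemma succ_evaluates:
  assumes "computable codeA codeS T"
  shows "\<exists>e. \<forall>s\<in>states T. i < length (succ_list B codeA codeS T s) \<longrightarrow>
    evaluates e [codeS s] (snd (prod_decode (succ_list B codeA codeS T s ! i)))"
proof -
  obtain eo where eo: "\<forall>s\<in>states T. evaluates eo [codeS s] (out_code codeA codeS T s)"
    using assms by (auto simp: computable_def recursive_wrt_def)
  obtain F where F: "rec_fun (Suc 0) F" "\<forall>xs. i < length (elems B (xs ! 0)) \<longrightarrow> F xs = elems B (xs ! 0) ! i"
    using rec_fun_elem[of "Suc 0" "\<lambda>xs. xs ! 0" i B] rec_fun_nth[of 0 "Suc 0"] by auto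
  obtain h where h: "\<forall>xs. length xs = Suc 0 \<longrightarrow> evaluates h xs (snd (prod_decode (F xs)))"
    using rec_fun_snd_decode[OF F(1)] unfolding rec_fun_def by blast
  have "evaluates (Comp h [eo]) [codeS s] (snd (prod_decode (succ_list B codeA codeS T s ! i)))"
    if s: "s \<in> states T" and i: "i < length (succ_list B codeA codeS T s)" for s
  proof -
    have "F [out_code codeA codeS T s] = succ_list B codeA codeS T s ! i"
      using F(2) i by (simp add: succ_list_def)
    then have "evaluates h [out_code codeA codeS T s] (snd (prod_decode (succ_list B codeA codeS T s ! i)))"
      using h[rule_format, of "[out_code codeA codeS T s]"] by simp
    then show ?thesis
      by (rule evaluates.comp[rotated 2]) (use s eo in auto)
  qed
  then show ?thesis by blast
qed

theorem theorem1:
  fixes A :: "'a set" and D :: "'d set" and T :: "('s, 'a) ts"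
    and codeA :: "'a act \<Rightarrow> nat" and codeS :: "'s \<Rightarrow> nat"
  assumes "finite A" and "finite D" and "D \<noteq> {}"
    and "transition_system A T"
    and "inj_on codeA (act_tau A)" and "inj_on codeS (states T)"
    and "boundedly_branching T"
    and "computable codeA codeS T"
  shows "\<exists>M :: (nat, 'a, 'd) rtm. reactive_turing_machine A D M \<and>
           dp_branching_bisimilar T (rtm_ts D M)"
proof -
  obtain d0 where d0: "d0 \<in> D" using assms(3) by blast
  obtain B where B: "branching_degree_le T B"
    using assms(7) by (auto simp: boundedly_branching_def)
  let ?succ = "succ_list B codeA codeS T" and ?mn = "menu_code B codeA codeS T"
  obtain K where K: "\<And>s. s \<in> states T \<Longrightarrow> ?mn s < K"
    using menu_code_bounded[OF assms(1,4) B] by blast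
  obtain g where g: "\<And>s. s \<in> states T \<Longrightarrow> evaluates g [codeS s] (?mn s)"
    using menu_code_evaluates[OF assms(8)] by blast
  have "\<forall>i. \<exists>e. \<forall>s\<in>states T. i < length (?succ s) \<longrightarrow>
      evaluates e [codeS s] (snd (prod_decode (?succ s ! i)))"
    using succ_evaluates[OF assms(8)] by blast
  from choice[OF this] obtain e where e: "\<And>i s. s \<in> states T \<Longrightarrow> i < length (?succ s) \<Longrightarrow>
      evaluates (e i) [codeS s] (snd (prod_decode (?succ s ! i)))"
    by blast
  obtain e0 where "\<forall>xs. length xs = Suc 0 \<longrightarrow> evaluates e0 xs (codeS (initial T))"
    using rec_fun_const[of "Suc 0" "codeS (initial T)"] unfolding rec_fun_def by blast
  then have e0: "evaluates e0 [0] (codeS (initial T))" by simp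
  \<comment> \<open>Block 0 treats the initial state like a successor, computed from the blank tape
    as input 0; block \<open>Suc i\<close> computes successor \<open>i\<close>.\<close>
  define es where "es = e0 # map e [0..<B]"
  define \<rho> where "\<rho> s = (\<lambda>_ :: nat. 0 :: nat)(0 := codeS s)" for s
  obtain P ent where run: "\<And>i m y z. i < length es \<Longrightarrow> evaluates (es ! i) [m] y \<Longrightarrow> evaluates g [y] z \<Longrightarrow>
    z < K \<Longrightarrow> ((ent i, (\<lambda>_. 0)(0 := m)), (length P + z, (\<lambda>_. 0)(0 := y))) \<in> (cstep P)\<^sup>*"
    using dispatcher_ex[of es g K] by blast
  define V where "V = ent ` {..B} \<union> (\<Union>(targets ` set P))"
  obtain k where k: "tracks k P V"
    using tracks_ex[of "ent ` {..B}" P] by (auto simp: V_def)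
  define acts where "acts j = list_decode (snd (prod_decode j))" for j
  \<comment> \<open>Numbers below \<open>K\<close> that encode no menu need a finite, well-typed
    entry set too, hence the conditions \<open>a \<in> act_tau A\<close> and
    \<open>i < B\<close>.\<close>
  define menu where "menu j = {(a, ent (Suc i)) | a i. a \<in> act_tau A \<and> i < B \<and> i < length (acts j) \<and> codeA a = acts j ! i}"
    for j
  define acc where "acc j \<longleftrightarrow> fst (prod_decode j) = 1" for j :: nat
  have menu_sub: "menu j \<subseteq> act_tau A \<times> ent ` {..B}" for j
    by (auto simp: menu_def)
  interpret M: menu_machine k P V A D d0 K menu acc "ent 0"
  proof (intro menu_machine.intro k menu_machine_axioms.intro d0 conjI)
    fix j
    show "finite (menu j)"
      by (rule finite_subset[OF menu_sub]) (use assms(1) in \<open>simp add: act_tau_def\<close>)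
    show "menu j \<subseteq> act_tau A \<times> V"
      using menu_sub[of j] by (auto simp: V_def)
  qed
  have acts: "acts (?mn s) = map (\<lambda>x. fst (prod_decode x)) (?succ s)" for s
    by (simp add: acts_def menu_code_def)
  have len: "length (?succ s) \<le> B" for s
    by (simp add: succ_list_def length_elems)
  have go: "((ent (Suc i), \<rho> s), (length P + ?mn t, \<rho> t)) \<in> (cstep P)\<^sup>*"
    if "s \<in> states T" "t \<in> states T" "i < length (?succ s)" "?succ s ! i = prod_encode (a, codeS t)" for s t i a
    unfolding \<rho>_def
  proof (rule run)
    have "i < B" using that(3) len[of s] by simp
    then show "Suc i < length es" by (simp add: es_def)
    show "evaluates (es ! Suc i) [codeS s] (codeS t)"
      using e[OF that(1,3)] that(4) \<open>i < B\<close> by (simp add: es_def)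
  qed (use g K that in auto)
  have tr: "(s, a, t) \<in> transitions T \<Longrightarrow> s \<in> states T \<and> a \<in> act_tau A \<and> t \<in> states T" for s a t
    using assms(4) by (auto simp: transition_system_def)
  have "dp_branching_bisimilar T (rtm_ts D M.machine)"
  proof (rule M.menu_machine_bisimilar[OF assms(4) K, where \<rho> = \<rho>])
    fix s a t assume st: "(s, a, t) \<in> transitions T"
    then have "prod_encode (codeA a, codeS t) \<in> set (?succ s)"
      using tr[OF st] by (force simp: set_succ_list[OF B] out_def)
    then obtain i where i: "i < length (?succ s)" "?succ s ! i = prod_encode (codeA a, codeS t)"
      by (metis in_set_conv_nth)
    with len[of s] have "i < B" by simp
    with i tr[OF st] have "(a, ent (Suc i)) \<in> menu (?mn s)"
      by (auto simp: menu_def acts intro: exI[of _ i])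
    with go[of s t i "codeA a"] i tr[OF st]
    show "\<exists>x. (a, x) \<in> menu (?mn s) \<and> ((x, \<rho> s), (length P + ?mn t, \<rho> t)) \<in> (cstep P)\<^sup>*" by blast
  next
    fix s a x assume s: "s \<in> states T" and "(a, x) \<in> menu (?mn s)"
    then obtain i where i: "a \<in> act_tau A" "i < length (?succ s)" "x = ent (Suc i)"
      "codeA a = fst (prod_decode (?succ s ! i))"
      by (auto simp: menu_def acts)
    then have "?succ s ! i \<in> (\<lambda>(a, t). prod_encode (codeA a, codeS t)) ` out T s"
      using set_succ_list[OF B s, of codeA codeS] nth_mem by blast
    then obtain a' t where t: "(s, a', t) \<in> transitions T" "?succ s ! i = prod_encode (codeA a', codeS t)"
      by (auto simp: out_def)
    with i have "a' = a"
      using tr[OF t(1)] assms(5) by (auto dest: inj_onD)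
    with t go[OF s _ i(2) t(2)] tr[OF t(1)] i(3)
    show "\<exists>t. (s, a, t) \<in> transitions T \<and> ((x, \<rho> s), (length P + ?mn t, \<rho> t)) \<in> (cstep P)\<^sup>*" by blast
  next
    have "initial T \<in> states T" using assms(4) by (simp add: transition_system_def)
    then have "((ent 0, (\<lambda>_. 0)(0 := 0)), (length P + ?mn (initial T), \<rho> (initial T))) \<in> (cstep P)\<^sup>*"
      unfolding \<rho>_def by (intro run) (use e0 g K in \<open>auto simp: es_def\<close>)
    then show "((ent 0, \<lambda>_. 0), (length P + ?mn (initial T), \<rho> (initial T))) \<in> (cstep P)\<^sup>*"
      by (simp add: fun_upd_idem)
  qed (auto simp: acc_def menu_code_def)
  with M.machine_rtm show ?thesis by blast
qed

end
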